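(* Any one-dimensional ISP-domain is almost Dedekind. Consequently, every Noetherian ISP-domain is a Dedekind domain.
   Context: All rings are commutative and unitary; "ideal" of a domain means integral ideal; dimension means Krull dimension. A domain $A$ is an ISP-domain (invertible semiprime domain) if every proper nonzero ideal $I$ of $A$ can be written as $I=JQ_1\cdots Q_n$ where $n\geq 1$, $J$ is an invertible ideal of $A$ and each $Q_i$ is a proper radical ideal of $A$. A domain $A$ is almost Dedekind if for every maximal ideal $M$ of $A$ the localization $A_M$ is a rank one discrete valuation domain (DVR). In the second assertion, fields are counted as (trivial) Dedekind domains. *)

theory Defs
  imports "HOL-Algebra.Algebra" "HOL-Library.Extended_Nat"
begin

section \<open>Rings of fractions of a domain\<close>

text \<open>The class of the fraction \<open>a / s\<close>. The relation \<open>a / s = b / t\<close> iff \<open>a t = b s\<close> is the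
  correct one when \<open>R\<close> is a domain and \<open>S\<close> is a multiplicative subset of \<open>R\<close> without zero; this
  is the only case in which it is used.\<close>

definition fraction :: "('a, 'b) ring_scheme \<Rightarrow> 'a set \<Rightarrow> 'a \<Rightarrow> 'a \<Rightarrow> ('a \<times> 'a) set" where
  "fraction R S a s = {(b, t) \<in> carrier R \<times> S. a \<otimes>\<^bsub>R\<^esub> t = b \<otimes>\<^bsub>R\<^esub> s}"

text \<open>In \<open>mult\<close> and \<open>add\<close> the unions range over all representatives of the two classes; all
  sets in the union are equal.\<close>

definition localization :: "('a, 'b) ring_scheme \<Rightarrow> 'a set \<Rightarrow> ('a \<times> 'a) set ring" where
  "localization R S =
    \<lparr> carrier = {fraction R S a s | a s. a \<in> carrier R \<and> s \<in> S},
      monoid.mult = (\<lambda>A B. \<Union>(a, s)\<in>A. \<Union>(b, t)\<in>B. fraction R S (a \<otimes>\<^bsub>R\<^esub> b) (s \<otimes>\<^bsub>R\<^esub> t)),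
      monoid.one = fraction R S \<one>\<^bsub>R\<^esub> \<one>\<^bsub>R\<^esub>,
      ring.zero = fraction R S \<zero>\<^bsub>R\<^esub> \<one>\<^bsub>R\<^esub>,
      ring.add = (\<lambda>A B. \<Union>(a, s)\<in>A. \<Union>(b, t)\<in>B.
               fraction R S (a \<otimes>\<^bsub>R\<^esub> t \<oplus>\<^bsub>R\<^esub> b \<otimes>\<^bsub>R\<^esub> s) (s \<otimes>\<^bsub>R\<^esub> t)) \<rparr>"

definition localization_at :: "('a, 'b) ring_scheme \<Rightarrow> 'a set \<Rightarrow> ('a \<times> 'a) set ring" where
  "localization_at R P = localization R (carrier R - P)"

definition fraction_field :: "('a, 'b) ring_scheme \<Rightarrow> ('a \<times> 'a) set ring" where
  "fraction_field R = localization R (carrier R - {\<zero>\<^bsub>R\<^esub>})"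

definition frac_embed :: "('a, 'b) ring_scheme \<Rightarrow> 'a \<Rightarrow> ('a \<times> 'a) set" where
  "frac_embed R a = fraction R (carrier R - {\<zero>\<^bsub>R\<^esub>}) a \<one>\<^bsub>R\<^esub>"


section \<open>Invertible ideals, radical ideals, ISP-domains\<close>

definition fractional_ideal :: "('a \<times> 'a) set set \<Rightarrow> ('a, 'b) ring_scheme \<Rightarrow> bool" where
  "fractional_ideal N R \<longleftrightarrow>
     additive_subgroup N (fraction_field R) \<and>
     (\<forall>r \<in> carrier R. \<forall>x \<in> N. frac_embed R r \<otimes>\<^bsub>fraction_field R\<^esub> x \<in> N) \<and>
     (\<exists>d \<in> carrier R - {\<zero>\<^bsub>R\<^esub>}. \<forall>x \<in> N.
        frac_embed R d \<otimes>\<^bsub>fraction_field R\<^esub> x \<in> frac_embed R ` carrier R)"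

text \<open>The library's \<open>ideal_prod\<close> makes sense for arbitrary subsets of a ring (finite nonempty sums
  of products), hence also for fractional ideals inside the fraction field.\<close>

definition invertible_ideal :: "'a set \<Rightarrow> ('a, 'b) ring_scheme \<Rightarrow> bool" where
  "invertible_ideal I R \<longleftrightarrow> ideal I R \<and>
     (\<exists>N. fractional_ideal N R \<and>
        ideal_prod (fraction_field R) (frac_embed R ` I) N = frac_embed R ` carrier R)"

definition ideal_radical :: "('a, 'b) ring_scheme \<Rightarrow> 'a set \<Rightarrow> 'a set" where
  "ideal_radical R I = {x \<in> carrier R. \<exists>n::nat. x [^]\<^bsub>R\<^esub> n \<in> I}"

definition radical_ideal :: "'a set \<Rightarrow> ('a, 'b) ring_scheme \<Rightarrow> bool" where
  "radical_ideal I R \<longleftrightarrow> ideal I R \<and> ideal_radical R I = I"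

definition ISP_domain :: "('a, 'b) ring_scheme \<Rightarrow> bool" where
  "ISP_domain R \<longleftrightarrow> domain R \<and>
     (\<forall>I. ideal I R \<and> I \<noteq> carrier R \<and> I \<noteq> {\<zero>\<^bsub>R\<^esub>} \<longrightarrow>
        (\<exists>J Qs. invertible_ideal J R \<and> Qs \<noteq> [] \<and>
           (\<forall>Q \<in> set Qs. radical_ideal Q R \<and> Q \<noteq> carrier R) \<and>
           I = foldl (ideal_prod R) J Qs))"


section \<open>Krull dimension\<close>

definition prime_chain :: "('a, 'b) ring_scheme \<Rightarrow> nat \<Rightarrow> (nat \<Rightarrow> 'a set) \<Rightarrow> bool" where
  "prime_chain R n P \<longleftrightarrow> (\<forall>i \<le> n. primeideal (P i) R) \<and> (\<forall>i < n. P i \<subset> P (Suc i))"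

text \<open>For the zero ring this gives \<open>0\<close>; it is only used for domains.\<close>

definition krull_dim :: "('a, 'b) ring_scheme \<Rightarrow> enat" where
  "krull_dim R = (SUP n \<in> {n. \<exists>P. prime_chain R n P}. enat n)"


section \<open>Almost Dedekind and Dedekind domains\<close>

text \<open>A discrete valuation has value group all of \<open>\<int>\<close>; it is unspecified at zero, where its value
  would be infinite.\<close>

definition discrete_valuation :: "('a, 'b) ring_scheme \<Rightarrow> ('a \<Rightarrow> int) \<Rightarrow> bool" where
  "discrete_valuation K v \<longleftrightarrow> field K \<and> v \<in> epi (mult_of K) integer_group \<and>
     (\<forall>x \<in> carrier K - {\<zero>\<^bsub>K\<^esub>}. \<forall>y \<in> carrier K - {\<zero>\<^bsub>K\<^esub>}.
        x \<oplus>\<^bsub>K\<^esub> y \<noteq> \<zero>\<^bsub>K\<^esub> \<longrightarrow> min (v x) (v y) \<le> v (x \<oplus>\<^bsub>K\<^esub> y))"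

text \<open>Rank one discrete valuation domains; fields are excluded.\<close>

definition DVR :: "('a, 'b) ring_scheme \<Rightarrow> bool" where
  "DVR R \<longleftrightarrow> domain R \<and>
     (\<exists>v. discrete_valuation (fraction_field R) v \<and>
        frac_embed R ` carrier R =
          {x \<in> carrier (fraction_field R). x = \<zero>\<^bsub>fraction_field R\<^esub> \<or> 0 \<le> v x})"

definition almost_Dedekind :: "('a, 'b) ring_scheme \<Rightarrow> bool" where
  "almost_Dedekind R \<longleftrightarrow> domain R \<and> (\<forall>M. maximalideal M R \<longrightarrow> DVR (localization_at R M))"

text \<open>Polynomials are coefficient lists with the leading coefficient first.\<close>

definition integrally_closed :: "('a, 'b) ring_scheme \<Rightarrow> bool" where
  "integrally_closed R \<longleftrightarrow>
     (\<forall>x \<in> carrier (fraction_field R).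
        (\<exists>p. polynomial\<^bsub>fraction_field R\<^esub> (frac_embed R ` carrier R) p \<and> p \<noteq> [] \<and>
             lead_coeff p = \<one>\<^bsub>fraction_field R\<^esub> \<and>
             ring.eval (fraction_field R) p x = \<zero>\<^bsub>fraction_field R\<^esub>)
        \<longrightarrow> x \<in> frac_embed R ` carrier R)"

text \<open>The dimension bound is \<open>\<le> 1\<close>, so that fields are Dedekind domains.\<close>

definition Dedekind_domain :: "('a, 'b) ring_scheme \<Rightarrow> bool" where
  "Dedekind_domain R \<longleftrightarrow> noetherian_domain R \<and> integrally_closed R \<and> krull_dim R \<le> 1"

end

theory Submission
  imports Defs
begin

text \<open>Only a weak consequence of the ISP property is needed: a proper nonzero ideal is a product
  \<open>J Q\<close> with \<open>Q\<close> proper and radical. Apply it to an ideal \<open>I\<close> whose radical is a nonzero maximal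
  ideal \<open>M\<close>; then \<open>Q = M\<close>.

  In dimension one take \<open>I = x R\<^sub>M \<inter> R\<close> with \<open>0 \<noteq> x \<in> M\<close>. From \<open>x \<in> J M\<close> one finds \<open>j \<in> J\<close> and \<open>m \<in> M\<close>
  such that \<open>j m\<close> and \<open>x\<close> differ by a unit of \<open>R\<^sub>M\<close>, and then \<open>j M \<subseteq> x R\<^sub>M\<close> shows that \<open>m\<close> generates
  \<open>M R\<^sub>M\<close>.

  In the Noetherian case take \<open>I = M\<^sup>2 + x R\<close> with \<open>x \<in> M - M\<^sup>2\<close>. Here \<open>I = J M\<close> is not contained in
  \<open>M\<^sup>2\<close>, so \<open>J\<close> is not contained in \<open>M\<close>, hence \<open>I = M\<close>, and \<open>x\<close> generates \<open>M R\<^sub>M\<close> by Nakayama.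

  In both cases each nonzero element of \<open>R\<^sub>M\<close> is a unit times a power of the generator, so \<open>R\<^sub>M\<close> is a
  DVR. In the Noetherian case this holds at every nonzero maximal ideal and yields dimension at most
  one and integral closedness.\<close>


section \<open>Localizations of a domain and its fraction field\<close>

locale domain_mult_subset = domain R for R (structure) +
  fixes S :: "'a set"
  assumes S_carrier: "S \<subseteq> carrier R"
    and S_one: "\<one> \<in> S"
    and S_mult: "\<lbrakk>s \<in> S; t \<in> S\<rbrakk> \<Longrightarrow> s \<otimes> t \<in> S"
    and S_nonzero: "\<zero> \<notin> S"
begin

abbreviation "fr \<equiv> fraction R S"
abbreviation "L \<equiv> localization R S"

lemma S_closed [simp, intro]: "s \<in> S \<Longrightarrow> s \<in> carrier R"
  using S_carrier by blast

text \<open>A class contains its own representative, which gives one direction. For the other, two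
  cross-multiplied equations are chained and the common factor \<open>s\<close> is cancelled, which
  is possible because \<open>R\<close> is a domain and \<open>S\<close> avoids zero.\<close>

lemma frac_eq_iff:
  assumes "a \<in> carrier R" "s \<in> S" "b \<in> carrier R" "t \<in> S"
  shows "fr a s = fr b t \<longleftrightarrow> a \<otimes> t = b \<otimes> s"
proof
  assume "fr a s = fr b t"
  moreover have "(a, s) \<in> fr a s" using assms by (simp add: fraction_def)
  ultimately have "(a, s) \<in> fr b t" by simp
  then show "a \<otimes> t = b \<otimes> s" by (simp add: fraction_def)
next
  have sub: "fr a s \<subseteq> fr b t"
    if *: "a \<in> carrier R" "s \<in> S" "b \<in> carrier R" "t \<in> S" "a \<otimes> t = b \<otimes> s" for a s b t
  proof
    fix p assume "p \<in> fr a s"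
    then obtain c u where p: "p = (c, u)" "c \<in> carrier R" "u \<in> S" "a \<otimes> u = c \<otimes> s"
      by (auto simp: fraction_def)
    have "s \<otimes> (b \<otimes> u) = (b \<otimes> s) \<otimes> u" using *(1-4) p(2,3) by (simp add: m_ac)
    also have "\<dots> = (a \<otimes> t) \<otimes> u" using *(5) by simp
    also have "\<dots> = (a \<otimes> u) \<otimes> t" using *(1-4) p(2,3) by (simp add: m_ac)
    also have "\<dots> = (c \<otimes> s) \<otimes> t" using p(4) by simp
    also have "\<dots> = s \<otimes> (c \<otimes> t)" using *(1-4) p(2,3) by (simp add: m_ac)
    finally have "b \<otimes> u = c \<otimes> t"
      using m_lcancel[of s "b \<otimes> u" "c \<otimes> t"] * p S_nonzero by auto
    then show "p \<in> fr b t" using p by (simp add: fraction_def)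
  qed
  assume "a \<otimes> t = b \<otimes> s"
  then show "fr a s = fr b t" using sub[of a s b t] sub[of b t a s] assms by auto
qed

lemma frac_self: "\<lbrakk>a \<in> carrier R; s \<in> S\<rbrakk> \<Longrightarrow> (a, s) \<in> fr a s"
  by (simp add: fraction_def)

lemma frac_closed [simp, intro]: "\<lbrakk>a \<in> carrier R; s \<in> S\<rbrakk> \<Longrightarrow> fr a s \<in> carrier L"
  by (auto simp: localization_def)

lemma frac_cases:
  assumes "x \<in> carrier L"
  obtains a s where "a \<in> carrier R" "s \<in> S" "x = fr a s"
  using assms by (auto simp: localization_def)

text \<open>This is the well-definedness principle for the operations of
  \<open>localization\<close>: if \<open>F\<close> takes the same value on all representatives, the
  union over the two nonempty classes collapses to that value.\<close>

lemma UN_frac_const: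
  assumes "a \<in> carrier R" "s \<in> S" "b \<in> carrier R" "t \<in> S"
    and "\<And>a' s' b' t'. \<lbrakk>a' \<in> carrier R; s' \<in> S; b' \<in> carrier R; t' \<in> S; a \<otimes> s' = a' \<otimes> s;
      b \<otimes> t' = b' \<otimes> t\<rbrakk> \<Longrightarrow> F a' s' b' t' = F a s b t"
  shows "(\<Union>(a', s')\<in>fr a s. \<Union>(b', t')\<in>fr b t. F a' s' b' t') = F a s b t"
proof -
  have e: "F a' s' b' t' = F a s b t" if "(a', s') \<in> fr a s" "(b', t') \<in> fr b t" for a' s' b' t'
    using that assms(5) by (auto simp: fraction_def)
  then have "(\<Union>(a', s')\<in>fr a s. \<Union>(b', t')\<in>fr b t. F a' s' b' t') =
      (\<Union>p\<in>fr a s. \<Union>q\<in>fr b t. F a s b t)"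
    by (intro SUP_cong refl) (auto simp: e split: prod.splits)
  also have "\<dots> = F a s b t" using frac_self[of a s] frac_self[of b t] assms(1-4) by auto
  finally show ?thesis .
qed

lemma localization_mult:
  assumes "a \<in> carrier R" "s \<in> S" "b \<in> carrier R" "t \<in> S"
  shows "fr a s \<otimes>\<^bsub>L\<^esub> fr b t = fr (a \<otimes> b) (s \<otimes> t)"
proof -
  have "(\<Union>(a', s')\<in>fr a s. \<Union>(b', t')\<in>fr b t. fr (a' \<otimes> b') (s' \<otimes> t')) = fr (a \<otimes> b) (s \<otimes> t)"
  proof (rule UN_frac_const[OF assms])
    fix a' s' b' t'
    assume *: "a' \<in> carrier R" "s' \<in> S" "b' \<in> carrier R" "t' \<in> S"
      and e: "a \<otimes> s' = a' \<otimes> s" "b \<otimes> t' = b' \<otimes> t"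
    have "(a' \<otimes> b') \<otimes> (s \<otimes> t) = (a' \<otimes> s) \<otimes> (b' \<otimes> t)" using assms * by (simp add: m_ac)
    also have "\<dots> = (a \<otimes> s') \<otimes> (b \<otimes> t')" using e by simp
    also have "\<dots> = (a \<otimes> b) \<otimes> (s' \<otimes> t')" using assms * by (simp add: m_ac)
    finally show "fr (a' \<otimes> b') (s' \<otimes> t') = fr (a \<otimes> b) (s \<otimes> t)"
      using assms * S_mult by (subst frac_eq_iff) auto
  qed
  then show ?thesis by (simp add: localization_def)
qed

lemma localization_add:
  assumes "a \<in> carrier R" "s \<in> S" "b \<in> carrier R" "t \<in> S"
  shows "fr a s \<oplus>\<^bsub>L\<^esub> fr b t = fr (a \<otimes> t \<oplus> b \<otimes> s) (s \<otimes> t)"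
proof -
  have "(\<Union>(a', s')\<in>fr a s. \<Union>(b', t')\<in>fr b t. fr (a' \<otimes> t' \<oplus> b' \<otimes> s') (s' \<otimes> t')) =
    fr (a \<otimes> t \<oplus> b \<otimes> s) (s \<otimes> t)"
  proof (rule UN_frac_const[OF assms])
    fix a' s' b' t'
    assume *: "a' \<in> carrier R" "s' \<in> S" "b' \<in> carrier R" "t' \<in> S"
      and e: "a \<otimes> s' = a' \<otimes> s" "b \<otimes> t' = b' \<otimes> t"
    have "(a' \<otimes> t' \<oplus> b' \<otimes> s') \<otimes> (s \<otimes> t) = (a' \<otimes> s) \<otimes> (t' \<otimes> t) \<oplus> (b' \<otimes> t) \<otimes> (s' \<otimes> s)"
      using assms * by (simp add: m_ac l_distr r_distr)
    also have "\<dots> = (a \<otimes> s') \<otimes> (t' \<otimes> t) \<oplus> (b \<otimes> t') \<otimes> (s' \<otimes> s)" using e by simp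
    also have "\<dots> = (a \<otimes> t \<oplus> b \<otimes> s) \<otimes> (s' \<otimes> t')"
      using assms * by (simp add: m_ac l_distr r_distr)
    finally show "fr (a' \<otimes> t' \<oplus> b' \<otimes> s') (s' \<otimes> t') = fr (a \<otimes> t \<oplus> b \<otimes> s) (s \<otimes> t)"
      using assms * S_mult by (subst frac_eq_iff) auto
  qed
  then show ?thesis by (simp add: localization_def)
qed

lemma localization_one: "\<one>\<^bsub>L\<^esub> = fr \<one> \<one>"
  and localization_zero: "\<zero>\<^bsub>L\<^esub> = fr \<zero> \<one>"
  by (simp_all add: localization_def)

lemma frac_eq_zero_iff:
  assumes "a \<in> carrier R" "s \<in> S"
  shows "fr a s = \<zero>\<^bsub>L\<^esub> \<longleftrightarrow> a = \<zero>"
  using assms S_one by (simp add: localization_zero frac_eq_iff)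

lemma cring_localization: "cring L"
proof (rule cringI)
  note [simp] = localization_mult localization_add localization_one localization_zero S_one S_mult
  show "abelian_group L"
  proof (rule abelian_groupI)
    fix x y z assume x: "x \<in> carrier L" and y: "y \<in> carrier L"
    show "x \<oplus>\<^bsub>L\<^esub> y \<in> carrier L" using x y by (auto elim!: frac_cases)
    show "x \<oplus>\<^bsub>L\<^esub> y = y \<oplus>\<^bsub>L\<^esub> x"
      using x y by (auto elim!: frac_cases simp: a_comm m_comm)
    assume z: "z \<in> carrier L"
    show "x \<oplus>\<^bsub>L\<^esub> y \<oplus>\<^bsub>L\<^esub> z = x \<oplus>\<^bsub>L\<^esub> (y \<oplus>\<^bsub>L\<^esub> z)"
      using x y z by (auto elim!: frac_cases simp: m_ac a_ac l_distr r_distr)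
  next
    fix x assume x: "x \<in> carrier L"
    show "\<zero>\<^bsub>L\<^esub> \<oplus>\<^bsub>L\<^esub> x = x" using x by (auto elim!: frac_cases)
    then obtain a s where a: "a \<in> carrier R" "s \<in> S" "x = fr a s" using x by (auto elim!: frac_cases)
    have "fr (\<ominus> a) s \<oplus>\<^bsub>L\<^esub> x = \<zero>\<^bsub>L\<^esub>"
      using a by (simp add: frac_eq_iff l_minus l_neg)
    then show "\<exists>y\<in>carrier L. y \<oplus>\<^bsub>L\<^esub> x = \<zero>\<^bsub>L\<^esub>" using a by blast
  qed simp
  show "Group.comm_monoid L"
  proof (rule comm_monoidI)
    fix x y z assume x: "x \<in> carrier L" and y: "y \<in> carrier L"
    show "x \<otimes>\<^bsub>L\<^esub> y \<in> carrier L" using x y by (auto elim!: frac_cases)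
    show "x \<otimes>\<^bsub>L\<^esub> y = y \<otimes>\<^bsub>L\<^esub> x"
      using x y by (auto elim!: frac_cases simp: m_comm)
    assume z: "z \<in> carrier L"
    show "x \<otimes>\<^bsub>L\<^esub> y \<otimes>\<^bsub>L\<^esub> z = x \<otimes>\<^bsub>L\<^esub> (y \<otimes>\<^bsub>L\<^esub> z)"
      using x y z by (auto elim!: frac_cases simp: m_ac)
  next
    fix x assume x: "x \<in> carrier L"
    show "\<one>\<^bsub>L\<^esub> \<otimes>\<^bsub>L\<^esub> x = x" using x by (auto elim!: frac_cases)
  qed simp
  fix x y z assume "x \<in> carrier L" "y \<in> carrier L" "z \<in> carrier L"
  then obtain a s b t c u where *: "a \<in> carrier R" "s \<in> S" "b \<in> carrier R" "t \<in> S"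
    "c \<in> carrier R" "u \<in> S" and e: "x = fr a s" "y = fr b t" "z = fr c u"
    by (auto elim!: frac_cases)
  show "(x \<oplus>\<^bsub>L\<^esub> y) \<otimes>\<^bsub>L\<^esub> z = x \<otimes>\<^bsub>L\<^esub> z \<oplus>\<^bsub>L\<^esub> y \<otimes>\<^bsub>L\<^esub> z"
    using * unfolding e by (simp add: frac_eq_iff m_ac l_distr r_distr)
qed

lemma domain_localization: "domain L"
proof (intro domain.intro domain_axioms.intro)
  show "cring L" by (rule cring_localization)
  show "\<one>\<^bsub>L\<^esub> \<noteq> \<zero>\<^bsub>L\<^esub>" using S_one frac_eq_zero_iff[of \<one> \<one>] by (simp add: localization_one)
  fix x y assume *: "x \<otimes>\<^bsub>L\<^esub> y = \<zero>\<^bsub>L\<^esub>" "x \<in> carrier L" "y \<in> carrier L"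
  then obtain a s b t where "a \<in> carrier R" "s \<in> S" "b \<in> carrier R" "t \<in> S"
    "x = fr a s" "y = fr b t"
    by (auto elim!: frac_cases)
  then show "x = \<zero>\<^bsub>L\<^esub> \<or> y = \<zero>\<^bsub>L\<^esub>"
    using * S_mult integral[of a b] by (simp add: localization_mult frac_eq_zero_iff)
qed

end

section \<open>The fraction field and the embedding of the domain\<close>

context domain
begin

abbreviation "K \<equiv> fraction_field R"
abbreviation "\<iota> \<equiv> frac_embed R"

lemma domain_mult_subset_nonzero: "domain_mult_subset R (carrier R - {\<zero>})"
  by unfold_locales (auto simp: integral_iff)

interpretation nz: domain_mult_subset R "carrier R - {\<zero>}"
  by (rule domain_mult_subset_nonzero)

lemma frac_embed_closed [simp, intro]: "a \<in> carrier R \<Longrightarrow> \<iota> a \<in> carrier K"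
  by (auto simp: fraction_field_def frac_embed_def)

lemma frac_embed_mult:
  "\<lbrakk>a \<in> carrier R; b \<in> carrier R\<rbrakk> \<Longrightarrow> \<iota> (a \<otimes> b) = \<iota> a \<otimes>\<^bsub>K\<^esub> \<iota> b"
  using nz.S_one by (simp add: fraction_field_def frac_embed_def nz.localization_mult)

lemma frac_embed_add:
  "\<lbrakk>a \<in> carrier R; b \<in> carrier R\<rbrakk> \<Longrightarrow> \<iota> (a \<oplus> b) = \<iota> a \<oplus>\<^bsub>K\<^esub> \<iota> b"
  using nz.S_one by (simp add: fraction_field_def frac_embed_def nz.localization_add)

lemma frac_embed_one: "\<iota> \<one> = \<one>\<^bsub>K\<^esub>"
  and frac_embed_zero: "\<iota> \<zero> = \<zero>\<^bsub>K\<^esub>"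
  by (simp_all add: fraction_field_def frac_embed_def localization_def)

lemma frac_embed_inj:
  "\<lbrakk>a \<in> carrier R; b \<in> carrier R\<rbrakk> \<Longrightarrow> \<iota> a = \<iota> b \<longleftrightarrow> a = b"
  using nz.S_one by (simp add: frac_embed_def nz.frac_eq_iff)

lemma frac_embed_eq_zero: "a \<in> carrier R \<Longrightarrow> \<iota> a = \<zero>\<^bsub>K\<^esub> \<longleftrightarrow> a = \<zero>"
  using frac_embed_inj[of a \<zero>] by (simp add: frac_embed_zero)

lemma domain_fraction_field: "domain K"
  unfolding fraction_field_def by (rule nz.domain_localization)

text \<open>Clearing the denominator replaces the fraction \<open>a / s\<close> by an equation
  between elements of the field, so that later arguments need not look inside the classes.\<close>

lemma fraction_field_cases:
  assumes "x \<in> carrier K"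
  obtains a s where "a \<in> carrier R" "s \<in> carrier R" "s \<noteq> \<zero>" "\<iota> s \<otimes>\<^bsub>K\<^esub> x = \<iota> a"
proof -
  obtain a s where *: "a \<in> carrier R" "s \<in> carrier R - {\<zero>}" "x = nz.fr a s"
    using assms nz.frac_cases unfolding fraction_field_def by blast
  have "\<iota> s \<otimes>\<^bsub>K\<^esub> x = \<iota> a"
    using * nz.S_one nz.S_mult[of s \<one>]
    by (simp add: fraction_field_def frac_embed_def nz.localization_mult nz.frac_eq_iff m_ac)
  then show ?thesis using * that by blast
qed

lemma field_fraction_field: "field K"
proof -
  interpret K: domain K by (rule domain_fraction_field)
  show ?thesis
  proof (rule K.cring_fieldI2)
    show "\<zero>\<^bsub>K\<^esub> \<noteq> \<one>\<^bsub>K\<^esub>" using K.one_not_zero by metis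
    fix x assume x: "x \<in> carrier K" "x \<noteq> \<zero>\<^bsub>K\<^esub>"
    then obtain a s where *: "a \<in> carrier R" "s \<in> carrier R - {\<zero>}" "x = nz.fr a s"
      using nz.frac_cases unfolding fraction_field_def by blast
    then have a: "a \<in> carrier R - {\<zero>}" using x nz.frac_eq_zero_iff[of a s]
      by (auto simp: fraction_field_def)
    \<comment> \<open>The inverse of \<open>a / s\<close> is \<open>s / a\<close>.\<close>
    then have "x \<otimes>\<^bsub>K\<^esub> nz.fr s a = \<one>\<^bsub>K\<^esub>"
      using * nz.S_one nz.S_mult[of s a]
      by (simp add: fraction_field_def nz.localization_mult nz.localization_one nz.frac_eq_iff m_ac)
    then show "\<exists>y\<in>carrier K. x \<otimes>\<^bsub>K\<^esub> y = \<one>\<^bsub>K\<^esub>"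
      using a * nz.frac_closed[of s a] by (auto simp: fraction_field_def)
  qed
qed

end


section \<open>Discrete valuation domains from a uniformizer\<close>

text \<open>An elementwise description of a DVR: up to units, every nonzero element is a power of
  one nonzero nonunit. The localization at a maximal ideal will be shown to have this form.\<close>

locale uniformizer = domain R for R (structure) +
  fixes \<pi>
  assumes pi_closed [simp, intro]: "\<pi> \<in> carrier R"
    and pi_nonunit: "\<pi> \<notin> Units R"
    and pi_nonzero: "\<pi> \<noteq> \<zero>"
    and unit_pi_power: "\<lbrakk>y \<in> carrier R; y \<noteq> \<zero>\<rbrakk> \<Longrightarrow> \<exists>u\<in>Units R. \<exists>k::nat. y = u \<otimes> \<pi> [^] k"
begin

section \<open>The valuation defined by a uniformizer\<close>

lemma pi_pow_nonzero: "\<pi> [^] (n::nat) \<noteq> \<zero>"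
  using pi_nonzero by (induction n) (auto simp: integral_iff)

text \<open>If \<open>m < n\<close>, cancelling \<open>\<pi> [^] m\<close> exhibits the unit
  \<open>u\<close> as a multiple of \<open>\<pi>\<close>, and a factor of a unit is a unit.\<close>

lemma unit_pi_power_unique_le:
  assumes "u \<in> Units R" "w \<in> Units R" "u \<otimes> \<pi> [^] m = w \<otimes> \<pi> [^] n"
  shows "n \<le> (m::nat)"
proof (rule ccontr)
  assume "\<not> n \<le> m"
  then obtain d where n: "n = m + Suc d" using less_iff_Suc_add by (metis not_le add_Suc_right)
  have c: "u \<in> carrier R" "w \<in> carrier R" using assms by auto
  have "\<pi> [^] m \<otimes> u = u \<otimes> \<pi> [^] m" using c by (simp add: m_comm)
  also have "\<dots> = w \<otimes> \<pi> [^] n" by (rule assms(3))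
  also have "\<dots> = \<pi> [^] m \<otimes> (w \<otimes> \<pi> [^] Suc d)"
    using c by (simp only: n nat_pow_mult[symmetric] pi_closed nat_pow_closed m_lcomm)
  finally have "u = w \<otimes> \<pi> [^] Suc d"
    using m_lcancel[of "\<pi> [^] m"] pi_pow_nonzero c by simp
  then have "u = \<pi> \<otimes> (w \<otimes> \<pi> [^] d)" using c by (simp add: m_ac)
  then have "\<pi> \<otimes> (w \<otimes> \<pi> [^] d) \<in> Units R" using assms(1) by simp
  then show False using pi_nonunit c unit_factor[of \<pi> "w \<otimes> \<pi> [^] d"] by simp
qed

lemma unit_pi_power_unique:
  assumes "u \<in> Units R" "w \<in> Units R" "u \<otimes> \<pi> [^] m = w \<otimes> \<pi> [^] n"
  shows "m = (n::nat)"
  using unit_pi_power_unique_le[OF assms] unit_pi_power_unique_le[OF assms(2,1) assms(3)[symmetric]]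
  by simp

text \<open>This says that \<open>x\<close> is a unit times \<pi> to the power \<open>i - j\<close>,
  with the denominator cleared so that only natural exponents occur. Many pairs \<open>i\<close>,
  \<open>j\<close> are admissible; only their difference is determined.\<close>

definition has_val :: "('a \<times> 'a) set \<Rightarrow> int \<Rightarrow> bool" where
  "has_val x n \<longleftrightarrow> (\<exists>u\<in>Units R. \<exists>i j::nat. n = int i - int j \<and>
     \<iota> (\<pi> [^] j) \<otimes>\<^bsub>K\<^esub> x = \<iota> (u \<otimes> \<pi> [^] i))"

lemma has_valI:
  assumes "u \<in> Units R" "\<iota> (\<pi> [^] j) \<otimes>\<^bsub>K\<^esub> x = \<iota> (u \<otimes> \<pi> [^] i)"
  shows "has_val x (int i - int j)"
  using assms unfolding has_val_def by blast

text \<open>No integer satisfies \<open>has_val\<close> at zero, so the value there is unspecified,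
  in agreement with \<open>discrete_valuation\<close>.\<close>

definition val :: "('a \<times> 'a) set \<Rightarrow> int" where
  "val x = (THE n. has_val x n)"

interpretation K: field K by (rule field_fraction_field)

lemma K_inverse:
  assumes "x \<in> carrier K" "x \<noteq> \<zero>\<^bsub>K\<^esub>"
  obtains y where "y \<in> carrier K" "x \<otimes>\<^bsub>K\<^esub> y = \<one>\<^bsub>K\<^esub>"
proof -
  have "x \<in> Units K" using assms by (simp add: K.field_Units)
  then show ?thesis using that K.Units_inv_closed K.Units_r_inv by blast
qed

text \<open>Multiplying each representation of \<open>x\<close> by the denominator of the other
  moves the comparison into \<open>R\<close>, where exponents are unique.\<close>

lemma has_val_unique:
  assumes "x \<in> carrier K" "has_val x m" "has_val x n"
  shows "m = n"
proof -
  obtain u i j where u: "u \<in> Units R" "m = int i - int j" "\<iota> (\<pi> [^] j) \<otimes>\<^bsub>K\<^esub> x = \<iota> (u \<otimes> \<pi> [^] i)"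
    using assms(2) unfolding has_val_def by blast
  obtain w k l where w: "w \<in> Units R" "n = int k - int l" "\<iota> (\<pi> [^] l) \<otimes>\<^bsub>K\<^esub> x = \<iota> (w \<otimes> \<pi> [^] k)"
    using assms(3) unfolding has_val_def by blast
  have c: "u \<in> carrier R" "w \<in> carrier R" using u w by auto
  have "\<iota> (u \<otimes> \<pi> [^] (i + l)) = \<iota> (\<pi> [^] l) \<otimes>\<^bsub>K\<^esub> \<iota> (u \<otimes> \<pi> [^] i)"
    using c by (simp add: frac_embed_mult[symmetric] nat_pow_mult[symmetric] m_ac)
  also have "\<dots> = \<iota> (\<pi> [^] j) \<otimes>\<^bsub>K\<^esub> \<iota> (w \<otimes> \<pi> [^] k)"
    unfolding u(3)[symmetric] w(3)[symmetric] using assms(1) by (simp add: K.m_ac frac_embed_closed)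
  also have "\<dots> = \<iota> (w \<otimes> \<pi> [^] (k + j))"
    using c by (simp add: frac_embed_mult[symmetric] nat_pow_mult[symmetric] m_ac)
  finally have "u \<otimes> \<pi> [^] (i + l) = w \<otimes> \<pi> [^] (k + j)" using c by (simp add: frac_embed_inj)
  then have "i + l = k + j" using unit_pi_power_unique u(1) w(1) by blast
  then show ?thesis using u w by linarith
qed

text \<open>Numerator and denominator of \<open>x\<close> are each a unit times a power of \<pi>;
  the exponents are subtracted and the units divided.\<close>

lemma has_val_exists:
  assumes "x \<in> carrier K" "x \<noteq> \<zero>\<^bsub>K\<^esub>"
  obtains n where "has_val x n"
proof -
  obtain a s where *: "a \<in> carrier R" "s \<in> carrier R" "s \<noteq> \<zero>" "\<iota> s \<otimes>\<^bsub>K\<^esub> x = \<iota> a"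
    using fraction_field_cases assms(1) .
  have "a \<noteq> \<zero>"
  proof
    assume "a = \<zero>"
    then show False using * assms K.integral[of "\<iota> s" x]
      by (simp add: frac_embed_zero frac_embed_eq_zero frac_embed_closed)
  qed
  then obtain u i where u: "u \<in> Units R" "a = u \<otimes> \<pi> [^] (i::nat)" using unit_pi_power * by blast
  obtain w j where w: "w \<in> Units R" "s = w \<otimes> \<pi> [^] (j::nat)" using unit_pi_power * by blast
  have "\<iota> (\<pi> [^] j) = \<iota> (inv w \<otimes> s)"
    using w Units_closed[OF w(1)] by (simp add: m_assoc[symmetric])
  then have "\<iota> (\<pi> [^] j) \<otimes>\<^bsub>K\<^esub> x = \<iota> (inv w) \<otimes>\<^bsub>K\<^esub> (\<iota> s \<otimes>\<^bsub>K\<^esub> x)"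
    using * w assms by (simp add: frac_embed_mult K.m_assoc frac_embed_closed)
  also have "\<dots> = \<iota> (inv w \<otimes> u \<otimes> \<pi> [^] i)"
    unfolding *(4) u(2) using Units_closed[OF u(1)] Units_inv_closed[OF w(1)]
    by (simp add: frac_embed_mult[symmetric] m_assoc)
  finally have "has_val x (int i - int j)" using u w by (intro has_valI[of "inv w \<otimes> u"]) auto
  then show ?thesis by (rule that)
qed

lemma val_eq: "\<lbrakk>x \<in> carrier K; has_val x n\<rbrakk> \<Longrightarrow> val x = n"
  unfolding val_def using has_val_unique by blast

lemma has_val_val: "\<lbrakk>x \<in> carrier K; x \<noteq> \<zero>\<^bsub>K\<^esub>\<rbrakk> \<Longrightarrow> has_val x (val x)"
  using has_val_exists val_eq by metis

lemma has_val_mult: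
  assumes x: "x \<in> carrier K" and y: "y \<in> carrier K" and "has_val x m" "has_val y n"
  shows "has_val (x \<otimes>\<^bsub>K\<^esub> y) (m + n)"
proof -
  obtain u i j where u: "u \<in> Units R" "m = int i - int j" "\<iota> (\<pi> [^] j) \<otimes>\<^bsub>K\<^esub> x = \<iota> (u \<otimes> \<pi> [^] i)"
    using assms(3) unfolding has_val_def by blast
  obtain w k l where w: "w \<in> Units R" "n = int k - int l" "\<iota> (\<pi> [^] l) \<otimes>\<^bsub>K\<^esub> y = \<iota> (w \<otimes> \<pi> [^] k)"
    using assms(4) unfolding has_val_def by blast
  have c: "u \<in> carrier R" "w \<in> carrier R" using u w by auto
  have "\<iota> (\<pi> [^] (j + l)) \<otimes>\<^bsub>K\<^esub> (x \<otimes>\<^bsub>K\<^esub> y) =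
      (\<iota> (\<pi> [^] j) \<otimes>\<^bsub>K\<^esub> x) \<otimes>\<^bsub>K\<^esub> (\<iota> (\<pi> [^] l) \<otimes>\<^bsub>K\<^esub> y)"
    using x y by (simp add: frac_embed_mult frac_embed_closed nat_pow_mult[symmetric] K.m_ac)
  also have "\<dots> = \<iota> ((u \<otimes> w) \<otimes> \<pi> [^] (i + k))"
    unfolding u(3) w(3) using c by (simp add: frac_embed_mult[symmetric] nat_pow_mult[symmetric] m_ac)
  finally have "has_val (x \<otimes>\<^bsub>K\<^esub> y) (int (i + k) - int (j + l))"
    using u w by (intro has_valI[of "u \<otimes> w"]) auto
  moreover have "m + n = int (i + k) - int (j + l)" using u w by simp
  ultimately show ?thesis by simp
qed

lemma val_mult:
  assumes "x \<in> carrier K" "x \<noteq> \<zero>\<^bsub>K\<^esub>" "y \<in> carrier K" "y \<noteq> \<zero>\<^bsub>K\<^esub>"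
  shows "val (x \<otimes>\<^bsub>K\<^esub> y) = val x + val y"
  using assms by (intro val_eq has_val_mult has_val_val) auto

text \<open>This identifies \<open>R\<close> as the valuation ring. If the exponent \<open>i\<close>
  of the numerator is at least the exponent \<open>j\<close> of the denominator, then
  \<open>\<pi> [^] j\<close> cancels and leaves an element of \<open>R\<close>.\<close>

lemma val_nonneg_iff:
  assumes "x \<in> carrier K" "x \<noteq> \<zero>\<^bsub>K\<^esub>"
  shows "0 \<le> val x \<longleftrightarrow> x \<in> \<iota> ` carrier R"
proof
  assume "0 \<le> val x"
  moreover obtain u i j where u: "u \<in> Units R" "val x = int i - int j"
    "\<iota> (\<pi> [^] j) \<otimes>\<^bsub>K\<^esub> x = \<iota> (u \<otimes> \<pi> [^] i)"
    using has_val_val[OF assms] unfolding has_val_def by blast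
  ultimately obtain d where i: "i = j + d" by (metis diff_ge_0_iff_ge le_Suc_ex zle_int)
  have c: "u \<in> carrier R" using u by auto
  have "\<iota> (\<pi> [^] j) \<otimes>\<^bsub>K\<^esub> x = \<iota> (\<pi> [^] j) \<otimes>\<^bsub>K\<^esub> \<iota> (u \<otimes> \<pi> [^] d)"
    unfolding u(3) i using c by (simp add: frac_embed_mult[symmetric] nat_pow_mult[symmetric] m_ac)
  then have "x = \<iota> (u \<otimes> \<pi> [^] d)"
    using K.m_lcancel[of "\<iota> (\<pi> [^] j)" x "\<iota> (u \<otimes> \<pi> [^] d)"] assms c
    by (simp add: frac_embed_closed frac_embed_eq_zero pi_pow_nonzero)
  then show "x \<in> \<iota> ` carrier R" using c by blast
next
  assume "x \<in> \<iota> ` carrier R"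
  then obtain a where a: "a \<in> carrier R" "x = \<iota> a" by blast
  then have "a \<noteq> \<zero>" using assms by (auto simp: frac_embed_zero)
  then obtain u i where u: "u \<in> Units R" "a = u \<otimes> \<pi> [^] (i::nat)" using unit_pi_power a by blast
  have "\<iota> (\<pi> [^] (0::nat)) \<otimes>\<^bsub>K\<^esub> x = \<iota> (u \<otimes> \<pi> [^] i)"
    using a u assms by (simp add: frac_embed_one)
  then have "has_val x (int i)" using has_valI[OF u(1), of 0 x i] by simp
  then show "0 \<le> val x" using val_eq assms by simp
qed

text \<open>The summand of smaller value is factored out: \<open>x + y = x (1 + y / x)\<close>. The
  quotient \<open>y / x\<close> has nonnegative value, hence it and the second factor lie in
  \<open>R\<close>.\<close>

lemma val_add_le:
  assumes x: "x \<in> carrier K" "x \<noteq> \<zero>\<^bsub>K\<^esub>" and y: "y \<in> carrier K" "y \<noteq> \<zero>\<^bsub>K\<^esub>"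
    and xy: "x \<oplus>\<^bsub>K\<^esub> y \<noteq> \<zero>\<^bsub>K\<^esub>" and le: "val x \<le> val y"
  shows "val x \<le> val (x \<oplus>\<^bsub>K\<^esub> y)"
proof -
  obtain x' where x': "x' \<in> carrier K" "x \<otimes>\<^bsub>K\<^esub> x' = \<one>\<^bsub>K\<^esub>"
    using K_inverse x .
  define z where "z = x' \<otimes>\<^bsub>K\<^esub> y"
  have z: "z \<in> carrier K" "y = x \<otimes>\<^bsub>K\<^esub> z"
    using x x' y by (simp_all add: z_def K.m_assoc[symmetric])
  then have z0: "z \<noteq> \<zero>\<^bsub>K\<^esub>" using y x by auto
  then have "0 \<le> val z" using le val_mult[of x z] x z by simp
  then obtain a where a: "a \<in> carrier R" "z = \<iota> a" using val_nonneg_iff z z0 by blast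
  have e: "x \<oplus>\<^bsub>K\<^esub> y = x \<otimes>\<^bsub>K\<^esub> \<iota> (\<one> \<oplus> a)"
    using a x z(2) by (simp add: frac_embed_add frac_embed_one K.r_distr frac_embed_closed)
  moreover from this have "\<iota> (\<one> \<oplus> a) \<noteq> \<zero>\<^bsub>K\<^esub>" using xy x by auto
  moreover from this have "0 \<le> val (\<iota> (\<one> \<oplus> a))" using a by (subst val_nonneg_iff) auto
  ultimately show ?thesis using val_mult[of x "\<iota> (\<one> \<oplus> a)"] x a by simp
qed

lemma val_add:
  assumes "x \<in> carrier K" "x \<noteq> \<zero>\<^bsub>K\<^esub>" "y \<in> carrier K" "y \<noteq> \<zero>\<^bsub>K\<^esub>" "x \<oplus>\<^bsub>K\<^esub> y \<noteq> \<zero>\<^bsub>K\<^esub>"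
  shows "min (val x) (val y) \<le> val (x \<oplus>\<^bsub>K\<^esub> y)"
  using val_add_le[OF assms] val_add_le[OF assms(3,4,1,2)] assms
  by (cases "val x \<le> val y") (auto simp: K.a_comm)

lemma val_surj: "\<exists>x\<in>carrier K - {\<zero>\<^bsub>K\<^esub>}. val x = n"
proof -
  define x where "x m = \<iota> (\<pi> [^] (m::nat))" for m
  have x: "x m \<in> carrier K" "x m \<noteq> \<zero>\<^bsub>K\<^esub>" for m
    by (simp_all add: x_def frac_embed_closed frac_embed_eq_zero pi_pow_nonzero)
  have pos: "val (x m) = int m" for m
  proof -
    have "has_val (x m) (int m)"
      using has_valI[of \<one> 0 "x m" m] x[of m] by (simp add: x_def frac_embed_one)
    then show ?thesis using val_eq x by blast
  qed
  show ?thesis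
  proof (cases "0 \<le> n")
    case True
    then show ?thesis using pos[of "nat n"] x[of "nat n"] by auto
  next
    case False
    \<comment> \<open>A negative \<open>n\<close> is the value of the inverse of
      \<open>\<pi> [^] m\<close>.\<close>
    define m where "m = nat (- n)"
    obtain y where y: "y \<in> carrier K" "x m \<otimes>\<^bsub>K\<^esub> y = \<one>\<^bsub>K\<^esub>"
      using K_inverse x[of m] .
    then have y0: "y \<noteq> \<zero>\<^bsub>K\<^esub>" using x[of m] by auto
    have "int m + val y = val (x 0)"
      using val_mult[of "x m" y] x[of m] y y0 pos[of m] by (simp add: x_def frac_embed_one)
    then have "val y = n" using pos[of 0] False by (simp add: m_def)
    then show ?thesis using y y0 by blast
  qed
qed

lemma DVR: "DVR R"
proof -
  have "n \<in> val ` (carrier K - {\<zero>\<^bsub>K\<^esub>})" for n using val_surj[of n] by blast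
  then have "val ` (carrier K - {\<zero>\<^bsub>K\<^esub>}) = UNIV" by blast
  moreover have "val \<in> hom (mult_of K) integer_group"
    using val_mult by (intro homI) (simp_all add: integer_group_def)
  ultimately have "val \<in> epi (mult_of K) integer_group"
    by (simp add: epi_def integer_group_def)
  then have "discrete_valuation K val"
    unfolding discrete_valuation_def using field_fraction_field val_add by simp
  moreover have "\<iota> ` carrier R = {x \<in> carrier K. x = \<zero>\<^bsub>K\<^esub> \<or> 0 \<le> val x}"
  proof (intro equalityI subsetI)
    fix x assume "x \<in> \<iota> ` carrier R"
    moreover from this have "x \<in> carrier K" by (auto simp: frac_embed_closed)
    ultimately show "x \<in> {x \<in> carrier K. x = \<zero>\<^bsub>K\<^esub> \<or> 0 \<le> val x}"
      using val_nonneg_iff[of x] by auto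
  next
    fix x assume "x \<in> {x \<in> carrier K. x = \<zero>\<^bsub>K\<^esub> \<or> 0 \<le> val x}"
    moreover have "\<zero>\<^bsub>K\<^esub> \<in> \<iota> ` carrier R" using frac_embed_zero[symmetric] by simp
    ultimately show "x \<in> \<iota> ` carrier R" using val_nonneg_iff[of x] by auto
  qed
  ultimately show ?thesis unfolding DVR_def using domain_axioms by blast
qed

end


section \<open>Ideals, and elements modulo units of the localization at a maximal ideal\<close>

context cring
begin

text \<open>Negation is multiplication by \<open>\<ominus> \<one>\<close>, so closure under it
  follows from the last assumption.\<close>

lemma idealI':
  assumes "I \<subseteq> carrier R" "\<zero> \<in> I" "\<And>a b. \<lbrakk>a \<in> I; b \<in> I\<rbrakk> \<Longrightarrow> a \<oplus> b \<in> I"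
    and mult: "\<And>r a. \<lbrakk>r \<in> carrier R; a \<in> I\<rbrakk> \<Longrightarrow> r \<otimes> a \<in> I"
  shows "ideal I R"
proof (rule idealI)
  show "ring R" by (rule ring_axioms)
  show "subgroup I (add_monoid R)"
  proof (rule add.subgroupI)
    fix a assume a: "a \<in> I"
    then have "\<ominus> \<one> \<otimes> a = \<ominus> a" using assms(1) by (auto simp: l_minus)
    then show "\<ominus> a \<in> I" using mult[of "\<ominus> \<one>" a] a by simp
  qed (use assms in auto)
  fix a x assume *: "a \<in> I" "x \<in> carrier R"
  then show "x \<otimes> a \<in> I" by (rule mult[rotated])
  then show "a \<otimes> x \<in> I" using * assms(1) by (metis m_comm subsetD)
qed

lemma add_cgenideal_iff:
  "x \<in> I <+>\<^bsub>R\<^esub> PIdl a \<longleftrightarrow> (\<exists>p\<in>I. \<exists>r\<in>carrier R. x = p \<oplus> r \<otimes> a)"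
  by (auto simp: set_add_def' cgenideal_def)

lemma ideal_add_cgenideal:
  "\<lbrakk>ideal I R; a \<in> carrier R\<rbrakk> \<Longrightarrow> ideal (I <+>\<^bsub>R\<^esub> PIdl a) R"
  by (intro add_ideals cgenideal_ideal)

lemma subset_add_cgenideal:
  assumes "ideal I R" "a \<in> carrier R"
  shows "I \<subseteq> I <+>\<^bsub>R\<^esub> PIdl a"
proof
  interpret I: ideal I R by fact
  fix x assume "x \<in> I"
  then have "x = x \<oplus> \<zero> \<otimes> a" using assms(2) by simp
  then show "x \<in> I <+>\<^bsub>R\<^esub> PIdl a" using \<open>x \<in> I\<close> unfolding add_cgenideal_iff by blast
qed

lemma mem_add_cgenideal:
  assumes "ideal I R" "a \<in> carrier R"
  shows "a \<in> I <+>\<^bsub>R\<^esub> PIdl a"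
proof -
  interpret I: ideal I R by fact
  have "a = \<zero> \<oplus> \<one> \<otimes> a" using assms(2) by simp
  then show ?thesis using I.zero_closed unfolding add_cgenideal_iff by blast
qed

text \<open>Zorn's lemma, for two purposes: with \<open>T = {\<one>}\<close> it produces maximal
  ideals, since avoiding \<one> means being proper; with a multiplicative set \<open>T\<close> it
  produces primes.\<close>

lemma exists_ideal_maximal_disjoint:
  assumes "ideal I R" "I \<inter> T = {}"
  shows "\<exists>P. ideal P R \<and> I \<subseteq> P \<and> P \<inter> T = {} \<and>
    (\<forall>J. ideal J R \<and> P \<subseteq> J \<and> J \<inter> T = {} \<longrightarrow> J = P)"
proof -
  let ?A = "{J. ideal J R \<and> I \<subseteq> J \<and> J \<inter> T = {}}"
  have "\<exists>P\<in>?A. \<forall>J\<in>?A. P \<subseteq> J \<longrightarrow> J = P"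
  proof (rule subset_Zorn_nonempty)
    show "?A \<noteq> {}" using assms by blast
    fix C assume C: "C \<noteq> {}" "subset.chain ?A C"
    then have sub: "C \<subseteq> ?A" by (simp add: subset.chain_def)
    have "subset.chain {J. ideal J R} C" using C(2) by (auto simp: subset.chain_def)
    from chain_Union_is_ideal[OF this] have "ideal (\<Union>C) R" using C(1) by simp
    moreover obtain J where "J \<in> C" using C(1) by blast
    then have "I \<subseteq> \<Union>C" using sub by blast
    moreover have "\<Union>C \<inter> T = {}" using sub by auto
    ultimately show "\<Union>C \<in> ?A" by simp
  qed
  then obtain P where P: "P \<in> ?A" "\<And>J. J \<in> ?A \<Longrightarrow> P \<subseteq> J \<Longrightarrow> J = P" by (elim bexE) simp
  have "J = P" if "ideal J R" "P \<subseteq> J" "J \<inter> T = {}" for J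
    using that P(1) by (intro P(2)) auto
  then show ?thesis using P(1) by blast
qed

lemma exists_maximalideal_superset:
  assumes "ideal I R" "I \<noteq> carrier R"
  obtains M where "maximalideal M R" "I \<subseteq> M"
proof -
  have "I \<inter> {\<one>} = {}" using assms ideal.one_imp_carrier by blast
  from exists_ideal_maximal_disjoint[OF assms(1) this]
  obtain P where P: "ideal P R" "I \<subseteq> P" "P \<inter> {\<one>} = {}"
    "\<forall>J. ideal J R \<and> P \<subseteq> J \<and> J \<inter> {\<one>} = {} \<longrightarrow> J = P" by (elim exE conjE)
  have "maximalideal P R"
  proof (rule maximalidealI)
    show "ideal P R" by fact
    show "carrier R \<noteq> P" using P(3) one_closed by blast
    fix J assume J: "ideal J R" "P \<subseteq> J" "J \<subseteq> carrier R"
    show "J = P \<or> J = carrier R"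
    proof (cases "\<one> \<in> J")
      case True then show ?thesis using ideal.one_imp_carrier J by blast
    next
      case False then show ?thesis using P(4) J by blast
    qed
  qed
  then show ?thesis using that P by blast
qed

text \<open>An ideal \<open>P\<close> maximal among those disjoint from a multiplicative set is
  prime: for \<open>a\<close> and \<open>b\<close> outside \<open>P\<close>, both
  \<open>P + (a)\<close> and \<open>P + (b)\<close> meet \<open>T\<close>, and if \<open>a b\<close>
  were in \<open>P\<close>, the product of two such elements would lie in \<open>P\<close> and in
  \<open>T\<close>.\<close>

lemma exists_primeideal_disjoint:
  assumes I: "ideal I R" and disj: "I \<inter> T = {}"
    and T1: "\<one> \<in> T" and T: "\<And>s t. \<lbrakk>s \<in> T; t \<in> T\<rbrakk> \<Longrightarrow> s \<otimes> t \<in> T"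
  obtains P where "primeideal P R" "I \<subseteq> P" "P \<inter> T = {}"
proof -
  from exists_ideal_maximal_disjoint[OF I disj]
  obtain P where P: "ideal P R" "I \<subseteq> P" "P \<inter> T = {}"
    and max: "\<forall>J. ideal J R \<and> P \<subseteq> J \<and> J \<inter> T = {} \<longrightarrow> J = P" by (elim exE conjE)
  interpret P: ideal P R by (rule P)
  have meets: "\<exists>p\<in>P. \<exists>r\<in>carrier R. p \<oplus> r \<otimes> a \<in> T" if a: "a \<in> carrier R" "a \<notin> P" for a
  proof (rule ccontr)
    assume "\<not> ?thesis"
    then have "(P <+>\<^bsub>R\<^esub> PIdl a) \<inter> T = {}" by (auto simp: add_cgenideal_iff)
    then have "P <+>\<^bsub>R\<^esub> PIdl a = P"
      using a P max ideal_add_cgenideal subset_add_cgenideal by simp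
    then show False using mem_add_cgenideal[OF P(1) a(1)] a(2) by simp
  qed
  have "primeideal P R"
  proof (rule primeidealI)
    show "ideal P R" by fact
    show "cring R" by (rule is_cring)
    show "carrier R \<noteq> P" using P T1 one_closed by blast
    fix a b assume ab: "a \<in> carrier R" "b \<in> carrier R" "a \<otimes> b \<in> P"
    show "a \<in> P \<or> b \<in> P"
    proof (rule ccontr)
      assume "\<not> ?thesis"
      then obtain p r q s where *: "p \<in> P" "r \<in> carrier R" "p \<oplus> r \<otimes> a \<in> T"
        "q \<in> P" "s \<in> carrier R" "q \<oplus> s \<otimes> b \<in> T"
        using meets ab by meson
      have c: "p \<in> carrier R" "q \<in> carrier R" using P.Icarr[OF *(1)] P.Icarr[OF *(4)] by auto
      \<comment> \<open>After expansion every term contains \<open>p\<close>, \<open>q\<close> or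
        the product \<open>a \<otimes> b\<close>, all of which lie in \<open>P\<close>.\<close>
      have "(p \<oplus> r \<otimes> a) \<otimes> (q \<oplus> s \<otimes> b) = (q \<oplus> s \<otimes> b) \<otimes> p \<oplus> ((r \<otimes> a) \<otimes> q \<oplus> (r \<otimes> s) \<otimes> (a \<otimes> b))"
        using ab * c by (simp add: l_distr r_distr m_ac a_ac)
      also have "\<dots> \<in> P" using ab * c by (simp add: P.a_closed P.I_l_closed)
      finally show False using T *(3,6) P(3) by blast
    qed
  qed
  then show ?thesis using that P by blast
qed

lemma foldl_ideal_prod_ideal:
  "\<lbrakk>ideal J R; \<forall>Q\<in>set Qs. ideal Q R\<rbrakk> \<Longrightarrow> ideal (foldl (ideal_prod R) J Qs) R"
  by (induction Qs arbitrary: J) (auto intro: ideal_prod_is_ideal)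

end

text \<open>The last radical factor is split off as \<open>Q\<close>, and everything before it is
  collected into the single ideal \<open>J\<close>. Radicality is recorded in the form used later:
  roots of elements of \<open>Q\<close> lie in \<open>Q\<close>.\<close>

lemma ISP_domain_factor:
  fixes R (structure)
  assumes "ISP_domain R" "ideal I R" "I \<noteq> carrier R" "I \<noteq> {\<zero>}"
  obtains J Q where "ideal J R" "ideal Q R" "Q \<noteq> carrier R" "I = J \<cdot> Q"
    "\<And>x n. \<lbrakk>x \<in> carrier R; x [^] (n::nat) \<in> Q\<rbrakk> \<Longrightarrow> x \<in> Q"
proof -
  interpret domain R using assms(1) by (simp add: ISP_domain_def)
  obtain J Qs where *: "invertible_ideal J R" "Qs \<noteq> []"
    "\<forall>Q\<in>set Qs. radical_ideal Q R \<and> Q \<noteq> carrier R" "I = foldl (ideal_prod R) J Qs"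
    using assms unfolding ISP_domain_def by metis
  obtain Qs' Q where Qs: "Qs = Qs' @ [Q]" using *(2) by (metis append_butlast_last_id)
  have rad: "radical_ideal Q R" "Q \<noteq> carrier R" "\<forall>Q\<in>set Qs'. ideal Q R"
    using *(3) by (auto simp: Qs radical_ideal_def)
  show ?thesis
  proof (rule that)
    show "ideal (foldl (ideal_prod R) J Qs') R"
      using *(1) rad(3) by (intro foldl_ideal_prod_ideal) (auto simp: invertible_ideal_def)
    show "ideal Q R" using rad(1) by (simp add: radical_ideal_def)
    show "I = foldl (ideal_prod R) J Qs' \<cdot> Q" by (simp add: *(4) Qs)
    fix x n assume "x \<in> carrier R" "x [^] (n::nat) \<in> Q"
    then show "x \<in> Q" using rad(1) unfolding radical_ideal_def ideal_radical_def by blast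
  qed (rule rad)
qed

section \<open>Elements of the domain up to units of the localization at \<open>M\<close>\<close>

locale domain_maximalideal = domain R + maximalideal M R for M and R (structure)
begin

abbreviation "S \<equiv> carrier R - M"

lemma S_one: "\<one> \<in> S"
  using I_notcarr one_imp_carrier by blast

lemma M_prime: "\<lbrakk>a \<in> carrier R; b \<in> carrier R; a \<otimes> b \<in> M\<rbrakk> \<Longrightarrow> a \<in> M \<or> b \<in> M"
  using maximalideal_prime[OF is_maximalideal] primeideal.I_prime by fast

lemma S_mult: "\<lbrakk>s \<in> S; t \<in> S\<rbrakk> \<Longrightarrow> s \<otimes> t \<in> S"
  using M_prime by auto

lemma S_nonzero: "s \<in> S \<Longrightarrow> s \<noteq> \<zero>"
  using zero_closed by auto

lemma S_diff: "\<lbrakk>s \<in> S; c \<in> M\<rbrakk> \<Longrightarrow> s \<ominus> c \<in> S"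
proof -
  assume *: "s \<in> S" "c \<in> M"
  then have c: "c \<in> carrier R" using Icarr by blast
  have "s = (s \<ominus> c) \<oplus> c" using * c by (simp add: minus_eq a_assoc l_neg)
  then show ?thesis using * c a_closed[of "s \<ominus> c" c] by auto
qed

lemma domain_mult_subset_compl: "domain_mult_subset R S"
  using S_one S_mult zero_closed by unfold_locales auto

text \<open>The equation \<open>M R\<^sub>M = p R\<^sub>M\<close> with denominators cleared.
  Elements of \<open>S\<close> are exactly the elements of \<open>R\<close> that become units of
  \<open>R\<^sub>M\<close>, so the statement stays inside \<open>R\<close>.\<close>

definition locally_generates :: "'a \<Rightarrow> bool" where
  "locally_generates p \<longleftrightarrow> p \<in> M \<and> (\<forall>y\<in>M. \<exists>t\<in>S. \<exists>b\<in>carrier R. t \<otimes> y = b \<otimes> p)"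

text \<open>The elementwise description of a DVR for \<open>R\<^sub>M\<close>, again with
  denominators cleared. Membership in \<open>M\<close> makes \<open>p\<close> a nonunit of
  \<open>R\<^sub>M\<close>.\<close>

definition locally_uniformizes :: "'a \<Rightarrow> bool" where
  "locally_uniformizes p \<longleftrightarrow> p \<in> M \<and>
     (\<forall>y\<in>carrier R - {\<zero>}. \<exists>s\<in>S. \<exists>t\<in>S. \<exists>k::nat. s \<otimes> y = t \<otimes> p [^] k)"

lemma locally_generates_nonzero:
  assumes "locally_generates p" "M \<noteq> {\<zero>}"
  shows "p \<noteq> \<zero>"
proof
  assume p: "p = \<zero>"
  obtain y where y: "y \<in> M" "y \<noteq> \<zero>" using assms(2) zero_closed by blast
  then obtain t b where "t \<in> S" "b \<in> carrier R" "t \<otimes> y = b \<otimes> p"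
    using assms(1) unfolding locally_generates_def by blast
  then show False using y p Icarr S_nonzero by (auto simp: integral_iff)
qed

text \<open>The fraction \<open>p / 1\<close> satisfies the axioms of \<open>uniformizer\<close>. It
  is no unit because multiples of \<open>p\<close> stay in \<open>M\<close>. From
  \<open>u a = t p^k\<close> one gets that \<open>a / s\<close> is \<open>t / (u s)\<close> times a
  power of \<open>p / 1\<close>, and \<open>t / (u s)\<close> is a unit because both of its parts
  lie in \<open>S\<close>.\<close>

lemma DVR_localization:
  assumes p: "locally_uniformizes p" "p \<noteq> \<zero>"
  shows "DVR (localization_at R M)"
proof -
  interpret loc: domain_mult_subset R S by (rule domain_mult_subset_compl)
  interpret L: domain loc.L by (rule loc.domain_localization)
  have pM: "p \<in> M" "p \<in> carrier R" using p Icarr by (auto simp: locally_uniformizes_def)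
  have pow: "loc.fr p \<one> [^]\<^bsub>loc.L\<^esub> k = loc.fr (p [^] k) \<one>" for k :: nat
    using pM loc.S_one by (induction k) (simp_all add: loc.localization_one loc.localization_mult)
  interpret uniformizer loc.L "loc.fr p \<one>"
  proof unfold_locales
    show "loc.fr p \<one> \<in> carrier loc.L" using pM loc.S_one by blast
    show "loc.fr p \<one> \<noteq> \<zero>\<^bsub>loc.L\<^esub>" using pM p loc.S_one by (simp add: loc.frac_eq_zero_iff)
    show "loc.fr p \<one> \<notin> Units loc.L"
    proof
      assume "loc.fr p \<one> \<in> Units loc.L"
      then obtain x where x: "x \<in> carrier loc.L" "loc.fr p \<one> \<otimes>\<^bsub>loc.L\<^esub> x = \<one>\<^bsub>loc.L\<^esub>"
        using L.Units_r_inv L.Units_inv_closed by blast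
      then obtain b t where b: "b \<in> carrier R" "t \<in> S" "x = loc.fr b t" using loc.frac_cases by blast
      then have "p \<otimes> b = t"
        using x pM loc.S_one loc.S_mult[of \<one> t]
        by (simp add: loc.localization_mult loc.localization_one loc.frac_eq_iff)
      then show False using b pM I_r_closed by blast
    qed
    fix y assume y: "y \<in> carrier loc.L" "y \<noteq> \<zero>\<^bsub>loc.L\<^esub>"
    then obtain a s where a: "a \<in> carrier R" "s \<in> S" "y = loc.fr a s" using loc.frac_cases by blast
    then have "a \<noteq> \<zero>" using y by (simp add: loc.frac_eq_zero_iff)
    then obtain u t k where u: "u \<in> S" "t \<in> S" "u \<otimes> a = t \<otimes> p [^] (k::nat)"
      using p a(1) unfolding locally_uniformizes_def by blast
    have us: "u \<otimes> s \<in> S" using u(1) a(2) by (rule S_mult)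
    have "loc.fr t (u \<otimes> s) \<otimes>\<^bsub>loc.L\<^esub> loc.fr (u \<otimes> s) t = \<one>\<^bsub>loc.L\<^esub>"
      using u(1,2) us loc.S_one S_mult[OF us u(2)] a(2)
      by (simp add: loc.localization_mult loc.localization_one loc.frac_eq_iff m_comm)
    then have "loc.fr t (u \<otimes> s) \<in> Units loc.L"
      using u us a L.m_comm[of "loc.fr t (u \<otimes> s)" "loc.fr (u \<otimes> s) t"]
      unfolding Units_def by (auto intro!: bexI[of _ "loc.fr (u \<otimes> s) t"])
    moreover have "y = loc.fr t (u \<otimes> s) \<otimes>\<^bsub>loc.L\<^esub> loc.fr p \<one> [^]\<^bsub>loc.L\<^esub> k"
    proof -
      have "a \<otimes> (u \<otimes> s) = (u \<otimes> a) \<otimes> s" using a(1,2) u(1) by (simp add: m_ac)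
      then have "a \<otimes> (u \<otimes> s) = (t \<otimes> p [^] k) \<otimes> s" using u(3) by simp
      then show ?thesis
        using a u us pM loc.S_one S_mult[OF us loc.S_one]
        by (simp add: pow loc.localization_mult loc.frac_eq_iff)
    qed
    ultimately show "\<exists>u\<in>Units loc.L. \<exists>k::nat. y = u \<otimes>\<^bsub>loc.L\<^esub> loc.fr p \<one> [^]\<^bsub>loc.L\<^esub> k" by blast
  qed
  show ?thesis unfolding localization_at_def by (rule DVR)
qed

text \<open>The assumption \<open>div\<close> says that in \<open>R\<^sub>M\<close> every nonzero
  \<open>y\<close> divides a power of \<open>p\<close>. In \<open>s p^k = y z\<close> the exponent
  is lowered as long as the cofactor \<open>z\<close> lies in \<open>M\<close>: then
  \<open>z\<close> is locally a multiple of \<open>p\<close>, and one factor \<open>p\<close>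
  cancels. Once \<open>z\<close> is outside \<open>M\<close>, the equation itself is the required
  representation of \<open>y\<close>.\<close>

lemma locally_uniformizesI:
  assumes gen: "locally_generates p"
    and div: "\<And>y. y \<in> carrier R - {\<zero>} \<Longrightarrow> \<exists>s\<in>S. \<exists>k::nat. \<exists>z\<in>carrier R. s \<otimes> p [^] k = y \<otimes> z"
    and p0: "p \<noteq> \<zero>"
  shows "locally_uniformizes p"
proof -
  have pM: "p \<in> M" "p \<in> carrier R" using gen Icarr by (auto simp: locally_generates_def)
  have "\<exists>s'\<in>S. \<exists>t\<in>S. \<exists>j::nat. s' \<otimes> y = t \<otimes> p [^] j"
    if "y \<in> carrier R" "z \<in> carrier R" "s \<in> S" "s \<otimes> p [^] (k::nat) = y \<otimes> z" for y z s k
    using that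
  proof (induction k arbitrary: s z)
    case 0
    \<comment> \<open>With exponent zero the product \<open>y \<otimes> z\<close> equals
      \<open>s\<close>, which is outside \<open>M\<close>; so \<open>y\<close> itself is a local
      unit.\<close>
    then have "y \<notin> M" using I_r_closed by auto
    then have "\<one> \<otimes> y = y \<otimes> p [^] (0::nat)" "y \<in> S" using 0 by auto
    then show ?case using S_one by blast
  next
    case (Suc k)
    show ?case
    proof (cases "z \<in> M")
      case True
      then obtain t b where t: "t \<in> S" "b \<in> carrier R" "t \<otimes> z = b \<otimes> p"
        using gen unfolding locally_generates_def by blast
      have "p \<otimes> ((t \<otimes> s) \<otimes> p [^] k) = t \<otimes> (s \<otimes> p [^] Suc k)"
        using t Suc.prems(2,3) pM by (simp add: m_ac)
      also have "\<dots> = y \<otimes> (t \<otimes> z)" unfolding Suc.prems(4) using t(1) Suc.prems(1,2) True Icarr by (simp add: m_ac)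
      also have "\<dots> = p \<otimes> (y \<otimes> b)" unfolding t(3) using t(2) Suc.prems(1,2) pM by (simp add: m_ac)
      finally have "(t \<otimes> s) \<otimes> p [^] k = y \<otimes> b"
        using m_lcancel[of p "(t \<otimes> s) \<otimes> p [^] k" "y \<otimes> b"] p0 pM t Suc.prems(1-3) by simp
      then show ?thesis using Suc.IH[of b "t \<otimes> s"] Suc.prems(1) t(2) S_mult[OF t(1) Suc.prems(3)] by blast
    next
      case False
      then show ?thesis using Suc by (metis DiffI m_comm)
    qed
  qed
  then show ?thesis using div pM unfolding locally_uniformizes_def by (metis DiffE)
qed

text \<open>The ideal \<open>y R\<^sub>M \<inter> R\<close>, where \<open>R\<^sub>M\<close> is the localization at \<open>M\<close>.\<close>

definition sat :: "'a \<Rightarrow> 'a set" where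
  "sat y = {a \<in> carrier R. \<exists>s\<in>S. \<exists>c\<in>carrier R. s \<otimes> a = c \<otimes> y}"

lemma sat_self: "y \<in> carrier R \<Longrightarrow> y \<in> sat y"
  using S_one by (auto simp: sat_def)

lemma sat_ideal:
  assumes y: "y \<in> carrier R"
  shows "ideal (sat y) R"
proof (rule idealI')
  show "sat y \<subseteq> carrier R" by (auto simp: sat_def)
  have "\<one> \<otimes> \<zero> = \<zero> \<otimes> y" using y by simp
  then show "\<zero> \<in> sat y" using S_one unfolding sat_def by blast
next
  fix a b assume "a \<in> sat y" "b \<in> sat y"
  then obtain s c t d where *: "a \<in> carrier R" "b \<in> carrier R" "s \<in> S" "c \<in> carrier R"
    "s \<otimes> a = c \<otimes> y" "t \<in> S" "d \<in> carrier R" "t \<otimes> b = d \<otimes> y"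
    unfolding sat_def by blast
  have "(s \<otimes> t) \<otimes> (a \<oplus> b) = t \<otimes> (s \<otimes> a) \<oplus> s \<otimes> (t \<otimes> b)"
    using *(1-4,6,7) by (simp add: r_distr m_ac)
  also have "\<dots> = (t \<otimes> c \<oplus> s \<otimes> d) \<otimes> y"
    unfolding *(5,8) using *(3,4,6,7) y by (simp add: l_distr r_distr m_ac)
  finally show "a \<oplus> b \<in> sat y" using * S_mult[of s t] unfolding sat_def by blast
next
  fix r a assume r: "r \<in> carrier R" and "a \<in> sat y"
  then obtain s c where *: "a \<in> carrier R" "s \<in> S" "c \<in> carrier R" "s \<otimes> a = c \<otimes> y"
    unfolding sat_def by blast
  have "s \<otimes> (r \<otimes> a) = r \<otimes> (s \<otimes> a)" using *(1-3) r by (simp add: m_ac)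
  also have "\<dots> = (r \<otimes> c) \<otimes> y" unfolding *(4) using *(1-3) r y by (simp add: m_ac)
  finally show "r \<otimes> a \<in> sat y" using r * unfolding sat_def by blast
qed

end


section \<open>The maximal ideal is locally principal\<close>

context domain_maximalideal
begin

lemma M_maximal: "\<lbrakk>ideal Q R; M \<subseteq> Q; Q \<noteq> carrier R\<rbrakk> \<Longrightarrow> Q = M"
  using I_maximal[of Q] additive_subgroup.a_subset[OF ideal.axioms(1)] by auto

lemma one_notin_M: "\<one> \<notin> M"
  using S_one by simp

lemma sat_proper:
  assumes "x \<in> M"
  shows "sat x \<noteq> carrier R"
proof
  assume "sat x = carrier R"
  then obtain s c where "s \<in> S" "c \<in> carrier R" "s \<otimes> \<one> = c \<otimes> x" unfolding sat_def by blast
  then show False using I_l_closed[OF assms] by auto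
qed

text \<open>In \<open>R\<^sub>M\<close> the only nonzero prime is the maximal ideal, so each
  \<open>m\<close> in \<open>M\<close> has a power divisible by \<open>y\<close>. Otherwise the
  principal ideal of \<open>y\<close> would avoid the multiplicative set \<open>T\<close> generated
  by \<open>S\<close> and \<open>m\<close>, and a prime containing \<open>y\<close> and avoiding
  \<open>T\<close> would be nonzero, inside \<open>M\<close> and different from
  \<open>M\<close>.\<close>

lemma exists_power_divisible:
  assumes one_dim: "\<And>P. \<lbrakk>primeideal P R; P \<noteq> {\<zero>}; P \<subseteq> M\<rbrakk> \<Longrightarrow> P = M"
    and y: "y \<in> carrier R" "y \<noteq> \<zero>" and m: "m \<in> M"
  shows "\<exists>s\<in>S. \<exists>k::nat. \<exists>z\<in>carrier R. s \<otimes> m [^] k = y \<otimes> z"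
proof (rule ccontr)
  assume no: "\<not> ?thesis"
  have mc: "m \<in> carrier R" using m Icarr by blast
  define T where "T = {s \<otimes> m [^] (k::nat) | s k. s \<in> S}"
  have disj: "PIdl y \<inter> T = {}"
  proof (rule ccontr)
    assume "PIdl y \<inter> T \<noteq> {}"
    then obtain z s k where "z \<in> carrier R" "s \<in> S" "z \<otimes> y = s \<otimes> m [^] (k::nat)"
      by (auto simp: T_def cgenideal_def)
    then show False using no y(1) m_comm by metis
  qed
  have ST: "S \<subseteq> T"
  proof
    fix s assume "s \<in> S"
    then have "s = s \<otimes> m [^] (0::nat)" by simp
    then show "s \<in> T" using \<open>s \<in> S\<close> unfolding T_def by blast
  qed
  have "m = \<one> \<otimes> m [^] (1::nat)" using mc by simp
  then have mT: "m \<in> T" using S_one unfolding T_def by blast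
  have T1: "\<one> \<in> T" using ST S_one by blast
  have Tm: "s \<otimes> t \<in> T" if "s \<in> T" "t \<in> T" for s t
  proof -
    obtain a k where a: "s = a \<otimes> m [^] (k::nat)" "a \<in> S" using \<open>s \<in> T\<close> unfolding T_def by blast
    obtain b l where b: "t = b \<otimes> m [^] (l::nat)" "b \<in> S" using \<open>t \<in> T\<close> unfolding T_def by blast
    have "s \<otimes> t = (a \<otimes> b) \<otimes> m [^] (k + l)"
      unfolding a(1) b(1) using a(2) b(2) mc by (simp add: nat_pow_mult[symmetric] m_ac)
    then show ?thesis using S_mult[OF a(2) b(2)] unfolding T_def by blast
  qed
  obtain P where P: "primeideal P R" "PIdl y \<subseteq> P" "P \<inter> T = {}"
    using exists_primeideal_disjoint[OF cgenideal_ideal[OF y(1)] disj T1 Tm] .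
  interpret P: primeideal P R by (rule P)
  have "y \<in> P" using P(2) cgenideal_self[OF y(1)] by blast
  then have "P \<noteq> {\<zero>}" using y(2) by blast
  moreover have "P \<subseteq> M" using P(3) ST P.Icarr by blast
  ultimately have "P = M" using one_dim P(1) by blast
  then show False using m mT P(3) by blast
qed

lemma locally_generates_if_one_dim:
  assumes isp: "ISP_domain R"
    and one_dim: "\<And>P. \<lbrakk>primeideal P R; P \<noteq> {\<zero>}; P \<subseteq> M\<rbrakk> \<Longrightarrow> P = M"
    and M0: "M \<noteq> {\<zero>}"
  obtains p where "locally_generates p"
proof -
  obtain x where x: "x \<in> M" "x \<noteq> \<zero>" "x \<in> carrier R" using M0 zero_closed Icarr by blast
  have "sat x \<noteq> {\<zero>}" using sat_self x by blast
  then obtain J Q where J: "ideal J R" and Q: "ideal Q R" "Q \<noteq> carrier R" and JQ: "sat x = J \<cdot> Q"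
    and rad: "\<And>x n. \<lbrakk>x \<in> carrier R; x [^] (n::nat) \<in> Q\<rbrakk> \<Longrightarrow> x \<in> Q"
    using ISP_domain_factor[OF isp sat_ideal[OF x(3)] sat_proper[OF x(1)]] by metis
  \<comment> \<open>Every \<open>m\<close> in \<open>M\<close> has a power in \<open>sat x\<close>,
    hence in the radical ideal \<open>Q\<close>.\<close>
  have "M \<subseteq> Q"
  proof
    fix m assume m: "m \<in> M"
    then have mc: "m \<in> carrier R" by (rule Icarr)
    obtain s k z where s: "s \<in> S" "z \<in> carrier R" "s \<otimes> m [^] (k::nat) = x \<otimes> z"
      using exists_power_divisible[OF one_dim x(3,2) m] by blast
    then have "s \<otimes> m [^] k = z \<otimes> x" using x(3) m_comm by simp
    then have "m [^] k \<in> sat x" using s(1,2) mc unfolding sat_def by blast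
    then show "m \<in> Q" using JQ ideal_prod_inter[OF J Q(1)] rad[OF mc] by blast
  qed
  then have QM: "Q = M" using M_maximal Q by blast
  \<comment> \<open>If no product \<open>j \<otimes> m\<close> were associated to \<open>x\<close>
    in \<open>R\<^sub>M\<close>, each would be \<open>x\<close> times a nonunit of
    \<open>R\<^sub>M\<close>. Sums preserve this property, so it would hold for \<open>x\<close>
    itself, and cancelling \<open>x\<close> would put an element of \<open>S\<close> into
    \<open>M\<close>.\<close>
  have "\<exists>j\<in>J. \<exists>m\<in>M. \<exists>s\<in>S. \<exists>a\<in>S. s \<otimes> (j \<otimes> m) = a \<otimes> x"
  proof (rule ccontr)
    assume no: "\<not> ?thesis"
    have "\<exists>s\<in>S. \<exists>a\<in>M. s \<otimes> z = a \<otimes> x" if "z \<in> J \<cdot> M" for z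
      using that
    proof (induction rule: ideal_prod.induct)
      case (prod j m)
      then have "j \<otimes> m \<in> sat x" unfolding JQ QM by (rule ideal_prod.prod)
      then obtain s a where "s \<in> S" "a \<in> carrier R" "s \<otimes> (j \<otimes> m) = a \<otimes> x"
        unfolding sat_def by blast
      then show ?case using no prod by blast
    next
      case (sum z w)
      then obtain s a t b where *: "s \<in> S" "a \<in> M" "s \<otimes> z = a \<otimes> x" "t \<in> S" "b \<in> M" "t \<otimes> w = b \<otimes> x"
        by blast
      have c: "a \<in> carrier R" "b \<in> carrier R" using * Icarr by auto
      have zw: "z \<in> carrier R" "w \<in> carrier R"
        using sum ideal_prod_in_carrier[OF J is_ideal] by auto
      have "(s \<otimes> t) \<otimes> (z \<oplus> w) = t \<otimes> (s \<otimes> z) \<oplus> s \<otimes> (t \<otimes> w)"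
        using *(1,4) zw by (simp add: r_distr m_ac)
      also have "\<dots> = (t \<otimes> a \<oplus> s \<otimes> b) \<otimes> x"
        unfolding *(3,6) using *(1,4) c x(3) by (simp add: l_distr r_distr m_ac)
      finally have "(s \<otimes> t) \<otimes> (z \<oplus> w) = (t \<otimes> a \<oplus> s \<otimes> b) \<otimes> x" .
      moreover have "t \<otimes> a \<oplus> s \<otimes> b \<in> M" using * by (intro a_closed I_l_closed) auto
      ultimately show ?case using S_mult[OF *(1,4)] by blast
    qed
    moreover have "x \<in> J \<cdot> M" using sat_self[OF x(3)] by (simp add: JQ QM)
    ultimately obtain s a where *: "s \<in> S" "a \<in> M" "s \<otimes> x = a \<otimes> x" by blast
    then have "s = a" using m_rcancel[of x s a] x Icarr by auto
    then show False using * by blast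
  qed
  then obtain j m s a where *: "j \<in> J" "m \<in> M" "s \<in> S" "a \<in> S" "s \<otimes> (j \<otimes> m) = a \<otimes> x" by blast
  have c: "j \<in> carrier R" "m \<in> carrier R" using * Icarr ideal.Icarr[OF J] by auto
  have j0: "j \<noteq> \<zero>"
  proof
    assume "j = \<zero>"
    then have "a \<otimes> x = \<zero>" using *(3,5) c by simp
    then show False using *(4) x S_nonzero by (auto simp: integral_iff)
  qed
  \<comment> \<open>The product \<open>j \<otimes> y\<close> lies in
    \<open>J \<cdot> M = sat x\<close>, so locally it is a multiple of \<open>x\<close>,
    equivalently of \<open>j \<otimes> m\<close>; then \<open>j\<close> cancels.\<close>
  have "\<exists>t\<in>S. \<exists>b\<in>carrier R. t \<otimes> y = b \<otimes> m" if y: "y \<in> M" for y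
  proof -
    have yc: "y \<in> carrier R" using y by (rule Icarr)
    have "j \<otimes> y \<in> sat x" unfolding JQ QM using *(1) y by (rule ideal_prod.prod)
    then obtain t d where t: "t \<in> S" "d \<in> carrier R" "t \<otimes> (j \<otimes> y) = d \<otimes> x"
      unfolding sat_def by blast
    have "j \<otimes> ((t \<otimes> a) \<otimes> y) = a \<otimes> (t \<otimes> (j \<otimes> y))" using t(1) *(4) yc c by (simp add: m_ac)
    also have "\<dots> = d \<otimes> (a \<otimes> x)" unfolding t(3) using t(2) *(4) x(3) by (simp add: m_ac)
    also have "\<dots> = j \<otimes> ((d \<otimes> s) \<otimes> m)"
      unfolding *(5)[symmetric] using t(2) *(3) c by (simp add: m_ac)
    finally have "(t \<otimes> a) \<otimes> y = (d \<otimes> s) \<otimes> m"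
      using m_lcancel[of j "(t \<otimes> a) \<otimes> y" "(d \<otimes> s) \<otimes> m"] j0 c yc t(1,2) *(3,4) by simp
    then show ?thesis using S_mult[OF t(1) *(4)] t(2) *(3) by blast
  qed
  then show ?thesis using that[of m] *(2) unfolding locally_generates_def by blast
qed

lemma DVR_localization_if_one_dim:
  assumes "ISP_domain R" "M \<noteq> {\<zero>}"
    and one_dim: "\<And>P. \<lbrakk>primeideal P R; P \<noteq> {\<zero>}; P \<subseteq> M\<rbrakk> \<Longrightarrow> P = M"
  shows "DVR (localization_at R M)"
proof -
  obtain p where p: "locally_generates p"
    using locally_generates_if_one_dim[OF assms(1) one_dim assms(2)] .
  then have "p \<in> M" by (simp add: locally_generates_def)
  have p0: "p \<noteq> \<zero>" using p assms(2) by (rule locally_generates_nonzero)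
  have "locally_uniformizes p"
    using p exists_power_divisible[OF one_dim _ _ \<open>p \<in> M\<close>] p0 by (intro locally_uniformizesI) auto
  then show ?thesis using p0 by (rule DVR_localization)
qed

section \<open>The Noetherian case: Nakayama's lemma and a local generator\<close>

text \<open>The determinant-free form of Nakayama's lemma: one generator is removed at a time, at the
  cost of a factor outside \<open>M\<close>.\<close>

lemma nakayama_step:
  assumes N: "ideal N R" and MN: "\<And>m. m \<in> M \<Longrightarrow> \<exists>n\<in>N. \<exists>q\<in>M \<cdot> M. m = n \<oplus> q"
    and a: "a \<in> M" and s: "s \<in> S"
    and sM: "\<And>m. m \<in> M \<Longrightarrow> s \<otimes> m \<in> N <+>\<^bsub>R\<^esub> PIdl a"
  shows "\<exists>s\<in>S. \<forall>m\<in>M. s \<otimes> m \<in> N"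
proof -
  interpret N: ideal N R by (rule N)
  have ac: "a \<in> carrier R" using a by (rule Icarr)
  \<comment> \<open>In a product \<open>i \<otimes> j\<close> the factor \<open>s\<close> is
    absorbed by \<open>j\<close>, and the resulting coefficient of \<open>a\<close> is multiplied by
    \<open>i\<close>, so it lands in \<open>M\<close>.\<close>
  have sq: "\<exists>n\<in>N. \<exists>c\<in>M. s \<otimes> q = n \<oplus> c \<otimes> a" if "q \<in> M \<cdot> M" for q
    using that
  proof (induction rule: ideal_prod.induct)
    case (prod i j)
    obtain n r where n: "n \<in> N" "r \<in> carrier R" "s \<otimes> j = n \<oplus> r \<otimes> a"
      using sM[OF prod(2)] unfolding add_cgenideal_iff by blast
    have c: "i \<in> carrier R" "j \<in> carrier R" using prod Icarr by auto
    have "s \<otimes> (i \<otimes> j) = i \<otimes> (s \<otimes> j)" using s c by (simp add: m_ac)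
    also have "\<dots> = i \<otimes> n \<oplus> (i \<otimes> r) \<otimes> a"
      unfolding n(3) using n(1,2) c ac N.Icarr by (simp add: r_distr m_ac)
    finally show ?case using N.I_l_closed[OF n(1) c(1)] I_r_closed[OF prod(1) n(2)] by blast
  next
    case (sum z w)
    then obtain n c n' c' where *: "n \<in> N" "c \<in> M" "s \<otimes> z = n \<oplus> c \<otimes> a"
      "n' \<in> N" "c' \<in> M" "s \<otimes> w = n' \<oplus> c' \<otimes> a" by blast
    have k: "n \<in> carrier R" "c \<in> carrier R" "n' \<in> carrier R" "c' \<in> carrier R"
      using * Icarr N.Icarr by auto
    have zw: "z \<in> carrier R" "w \<in> carrier R"
      using sum ideal_prod_in_carrier[OF is_ideal is_ideal] by auto
    have "s \<otimes> (z \<oplus> w) = (n \<oplus> c \<otimes> a) \<oplus> (n' \<oplus> c' \<otimes> a)"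
      using s zw *(3,6) by (simp add: r_distr)
    also have "\<dots> = (n \<oplus> n') \<oplus> (c \<oplus> c') \<otimes> a" using k ac by (simp add: l_distr a_ac)
    finally show ?case using N.a_closed[OF *(1,4)] a_closed[OF *(2,5)] by blast
  qed
  obtain n q where nq: "n \<in> N" "q \<in> M \<cdot> M" "a = n \<oplus> q" using MN[OF a] by blast
  obtain n' c where n': "n' \<in> N" "c \<in> M" "s \<otimes> q = n' \<oplus> c \<otimes> a" using sq[OF nq(2)] by blast
  have k: "n \<in> carrier R" "q \<in> carrier R" "n' \<in> carrier R" "c \<in> carrier R"
    using nq n' Icarr N.Icarr ideal_prod_in_carrier[OF is_ideal is_ideal] by auto
  have "s \<otimes> a = s \<otimes> n \<oplus> s \<otimes> q" using s k by (subst nq(3)) (simp add: r_distr)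
  then have "s \<otimes> a = (s \<otimes> n \<oplus> n') \<oplus> c \<otimes> a" using s k ac by (simp add: n'(3) a_assoc)
  \<comment> \<open>Moving the multiple \<open>c \<otimes> a\<close> to the left puts a multiple of
    \<open>a\<close> into \<open>N\<close>; its coefficient \<open>s \<ominus> c\<close> stays
    outside \<open>M\<close> because \<open>c\<close> is in \<open>M\<close>.\<close>
  then have "(s \<ominus> c) \<otimes> a = s \<otimes> n \<oplus> n'"
    using s k ac by (simp add: minus_eq l_distr l_minus a_assoc r_neg)
  then have sa: "(s \<ominus> c) \<otimes> a \<in> N" using s nq(1) n'(1) by (simp add: N.a_closed N.I_l_closed)
  have sc: "s \<ominus> c \<in> S" using s n'(2) by (rule S_diff)
  \<comment> \<open>The new factor works in two stages: \<open>s\<close> moves \<open>m\<close> into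
    \<open>N + (a)\<close>, and then \<open>s \<ominus> c\<close> moves the multiple of
    \<open>a\<close> into \<open>N\<close>.\<close>
  have "(s \<ominus> c) \<otimes> s \<otimes> m \<in> N" if m: "m \<in> M" for m
  proof -
    obtain \<nu> r where n: "\<nu> \<in> N" "r \<in> carrier R" "s \<otimes> m = \<nu> \<oplus> r \<otimes> a"
      using sM[OF m] unfolding add_cgenideal_iff by blast
    have "(s \<ominus> c) \<otimes> s \<otimes> m = (s \<ominus> c) \<otimes> (s \<otimes> m)"
      using sc s Icarr[OF m] by (simp add: m_assoc)
    also have "\<dots> = (s \<ominus> c) \<otimes> \<nu> \<oplus> r \<otimes> ((s \<ominus> c) \<otimes> a)"
      unfolding n(3) using sc n(1,2) ac N.Icarr by (simp add: r_distr m_ac)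
    also have "\<dots> \<in> N" using sa sc n(1,2) by (simp add: N.a_closed N.I_l_closed)
    finally show ?thesis .
  qed
  then show ?thesis using S_mult[OF sc s] by blast
qed

text \<open>Induction on \<open>A\<close> with \<open>N\<close> varying: the induction hypothesis is
  applied to \<open>N + (a)\<close>, and \<open>nakayama_step\<close> then removes \<open>a\<close>.
  The last assumption expresses that \<open>N\<close> and \<open>A\<close> together generate an
  ideal containing \<open>M\<close>.\<close>

lemma nakayama_finite:
  assumes "finite A" "A \<subseteq> M" "ideal N R" "\<And>m. m \<in> M \<Longrightarrow> \<exists>n\<in>N. \<exists>q\<in>M \<cdot> M. m = n \<oplus> q"
    and "\<And>N'. \<lbrakk>ideal N' R; N \<subseteq> N'; A \<subseteq> N'\<rbrakk> \<Longrightarrow> M \<subseteq> N'"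
  shows "\<exists>s\<in>S. \<forall>m\<in>M. s \<otimes> m \<in> N"
  using assms
proof (induction A arbitrary: N rule: finite_induct)
  case empty
  then have "M \<subseteq> N" by blast
  then show ?case using S_one Icarr by (intro bexI[of _ \<one>]) auto
next
  case (insert a A)
  have a: "a \<in> M" "a \<in> carrier R" using insert Icarr by auto
  let ?N = "N <+>\<^bsub>R\<^esub> PIdl a"
  have sub: "N \<subseteq> ?N" "a \<in> ?N"
    using subset_add_cgenideal mem_add_cgenideal insert.prems(2) a(2) by auto
  have "\<exists>s\<in>S. \<forall>m\<in>M. s \<otimes> m \<in> ?N"
  proof (rule insert.IH)
    show "A \<subseteq> M" using insert.prems(1) by blast
    show "ideal ?N R" using insert.prems(2) a(2) by (rule ideal_add_cgenideal)
    show "\<exists>n\<in>?N. \<exists>q\<in>M \<cdot> M. m = n \<oplus> q" if "m \<in> M" for m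
      using insert.prems(3)[OF that] sub(1) by blast
    show "M \<subseteq> N'" if "ideal N' R" "?N \<subseteq> N'" "A \<subseteq> N'" for N'
      using insert.prems(4)[of N'] that sub by blast
  qed
  then show ?case using nakayama_step[OF insert.prems(2,3) a(1)] by blast
qed

text \<open>If \<open>M\<close> is covered by \<open>N + M\<^sup>2\<close>, then
  \<open>M R\<^sub>M\<close> is contained in \<open>N R\<^sub>M\<close>. A single \<open>s\<close>
  serves all of \<open>M\<close> because \<open>M\<close> is finitely generated.\<close>

lemma nakayama:
  assumes "noetherian_ring R" "ideal N R"
    and "\<And>m. m \<in> M \<Longrightarrow> \<exists>n\<in>N. \<exists>q\<in>M \<cdot> M. m = n \<oplus> q"
  shows "\<exists>s\<in>S. \<forall>m\<in>M. s \<otimes> m \<in> N"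
proof -
  obtain A where A: "A \<subseteq> carrier R" "finite A" "M = Idl A"
    using noetherian_ring.finetely_gen[OF assms(1) is_ideal] by blast
  show ?thesis
  proof (rule nakayama_finite[OF A(2) _ assms(2,3)])
    show "A \<subseteq> M" using A genideal_self by blast
    show "M \<subseteq> N'" if "ideal N' R" "A \<subseteq> N'" for N'
      using genideal_minimal[OF that] A(3) by blast
  qed
qed

lemma locally_generates_if_noetherian:
  assumes isp: "ISP_domain R" and noeth: "noetherian_ring R" and M0: "M \<noteq> {\<zero>}"
  obtains p where "locally_generates p"
proof -
  have MM: "ideal (M \<cdot> M) R" "M \<cdot> M \<subseteq> M"
    using ideal_prod_is_ideal[OF is_ideal is_ideal] ideal_prod_inter[OF is_ideal is_ideal] by auto
  interpret MM: ideal "M \<cdot> M" R by (rule MM)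
  \<comment> \<open>Otherwise Nakayama with the zero ideal as \<open>N\<close> gives a nonzero
    element annihilating \<open>M\<close>, which is impossible in a domain.\<close>
  have "\<not> M \<subseteq> M \<cdot> M"
  proof
    assume sub: "M \<subseteq> M \<cdot> M"
    have "\<exists>n\<in>{\<zero>}. \<exists>q\<in>M \<cdot> M. m = n \<oplus> q" if "m \<in> M" for m
      using that sub Icarr[OF that] by auto
    from nakayama[OF noeth zeroideal this] obtain s where s: "s \<in> S" "\<forall>m\<in>M. s \<otimes> m \<in> {\<zero>}"
      by blast
    obtain m where "m \<in> M" "m \<noteq> \<zero>" using M0 zero_closed by blast
    then show False using s S_nonzero[OF s(1)] Icarr[of m] by (auto simp: integral_iff)
  qed
  then obtain x where x: "x \<in> M" "x \<notin> M \<cdot> M" "x \<in> carrier R" using Icarr by blast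
  define I where "I = M \<cdot> M <+>\<^bsub>R\<^esub> PIdl x"
  have I: "ideal I R" "M \<cdot> M \<subseteq> I" "x \<in> I"
    unfolding I_def using ideal_add_cgenideal subset_add_cgenideal mem_add_cgenideal MM(1) x(3) by auto
  have "I \<subseteq> M" unfolding I_def using x(1) MM(2)
    by (auto simp: add_cgenideal_iff intro!: a_closed I_l_closed)
  then have "I \<noteq> carrier R" using one_notin_M one_closed by blast
  moreover have "I \<noteq> {\<zero>}" using x(2) I(3) MM.zero_closed by blast
  ultimately obtain J Q where J: "ideal J R" and Q: "ideal Q R" "Q \<noteq> carrier R" and JQ: "I = J \<cdot> Q"
    and rad: "\<And>x n. \<lbrakk>x \<in> carrier R; x [^] (n::nat) \<in> Q\<rbrakk> \<Longrightarrow> x \<in> Q"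
    using ISP_domain_factor[OF isp I(1)] by metis
  interpret J: ideal J R by (rule J)
  have "M \<subseteq> Q"
  proof
    fix m assume m: "m \<in> M"
    then have mc: "m \<in> carrier R" by (rule Icarr)
    have "m [^] (2::nat) = m \<otimes> m" using mc by (simp add: numeral_2_eq_2)
    also have "\<dots> \<in> I" using I(2) ideal_prod.prod[OF m m, of R] by blast
    finally show "m \<in> Q" using JQ ideal_prod_inter[OF J Q(1)] rad[OF mc] by blast
  qed
  then have QM: "Q = M" using M_maximal Q by blast
  \<comment> \<open>Otherwise \<open>I = J \<cdot> M\<close> would lie in
    \<open>M \<cdot> M\<close>, although it contains \<open>x\<close>.\<close>
  have "\<not> J \<subseteq> M"
  proof
    assume "J \<subseteq> M"
    have "z \<in> M \<cdot> M" if "z \<in> J \<cdot> M" for z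
      using that by (induction rule: ideal_prod.induct)
        (use \<open>J \<subseteq> M\<close> in \<open>auto intro: ideal_prod.intros\<close>)
    then show False using I(3) x(2) by (auto simp: JQ QM)
  qed
  then obtain j where j: "j \<in> J" "j \<notin> M" "j \<in> carrier R" using J.Icarr by blast
  \<comment> \<open>By maximality \<open>M\<close> and \<open>j\<close> generate the unit ideal.
    Writing \<one> as \<open>m \<oplus> r \<otimes> j\<close> splits each \<open>y\<close> in
    \<open>M\<close> into a part in \<open>M \<cdot> M\<close> and a part in
    \<open>J \<cdot> M\<close>, both inside \<open>I\<close>.\<close>
  have "M <+>\<^bsub>R\<^esub> PIdl j = carrier R"
  proof (rule ccontr)
    assume "M <+>\<^bsub>R\<^esub> PIdl j \<noteq> carrier R"
    then have "M <+>\<^bsub>R\<^esub> PIdl j = M"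
      using M_maximal ideal_add_cgenideal subset_add_cgenideal is_ideal j(3) by metis
    then show False using mem_add_cgenideal[OF is_ideal j(3)] j(2) by simp
  qed
  then have "\<one> \<in> M <+>\<^bsub>R\<^esub> PIdl j" by simp
  then obtain m r where mr: "m \<in> M" "r \<in> carrier R" "\<one> = m \<oplus> r \<otimes> j"
    unfolding add_cgenideal_iff by blast
  have "y \<in> I" if y: "y \<in> M" for y
  proof -
    have yc: "y \<in> carrier R" using y by (rule Icarr)
    have "y = (m \<oplus> r \<otimes> j) \<otimes> y" using yc by (simp add: mr(3)[symmetric])
    also have "\<dots> = m \<otimes> y \<oplus> (r \<otimes> j) \<otimes> y" using yc mr(1,2) j Icarr by (simp add: l_distr)
    also have "\<dots> \<in> I"
    proof (rule additive_subgroup.a_closed[OF ideal.axioms(1)[OF I(1)]])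
      show "m \<otimes> y \<in> I" using I(2) ideal_prod.prod[OF mr(1) y, of R] by blast
      show "(r \<otimes> j) \<otimes> y \<in> I"
        unfolding JQ QM using J.I_l_closed[OF j(1) mr(2)] y by (rule ideal_prod.prod)
    qed
    finally show ?thesis .
  qed
  \<comment> \<open>Now \<open>M\<close> equals \<open>I\<close>, so modulo
    \<open>M \<cdot> M\<close> it is generated by \<open>x\<close>, and Nakayama applies with the
    principal ideal of \<open>x\<close> as \<open>N\<close>.\<close>
  then have "\<exists>n\<in>PIdl x. \<exists>q\<in>M \<cdot> M. m = n \<oplus> q" if "m \<in> M" for m
  proof -
    have "m \<in> I" using \<open>\<And>y. y \<in> M \<Longrightarrow> y \<in> I\<close> that .
    then obtain q r where q: "q \<in> M \<cdot> M" "r \<in> carrier R" "m = q \<oplus> r \<otimes> x"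
      unfolding I_def add_cgenideal_iff by blast
    then have "m = r \<otimes> x \<oplus> q" using x(3) MM.Icarr by (simp add: a_comm)
    then show ?thesis using q unfolding cgenideal_def by blast
  qed
  from nakayama[OF noeth cgenideal_ideal[OF x(3)] this]
  have "\<exists>s\<in>S. \<forall>m\<in>M. s \<otimes> m \<in> PIdl x" .
  then have "locally_generates x"
    unfolding locally_generates_def cgenideal_def using x(1) by blast
  then show ?thesis by (rule that)
qed

text \<open>Among the elements that are not locally a unit times a power of \<open>p\<close>, choose
  \<open>y\<close> with \<open>sat y\<close> maximal. It lies in \<open>M\<close>, so locally
  \<open>y = b p\<close>; then \<open>b\<close> is again such an element and \<open>sat y\<close> is
  contained in \<open>sat b\<close>. Equality would make \<open>p\<close> a unit of
  \<open>R\<^sub>M\<close>.\<close>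

lemma locally_uniformizes_if_noetherian:
  assumes noeth: "noetherian_ring R" and gen: "locally_generates p" and p0: "p \<noteq> \<zero>"
  shows "locally_uniformizes p"
proof (rule ccontr)
  have pM: "p \<in> M" "p \<in> carrier R" using gen Icarr by (auto simp: locally_generates_def)
  define rep where "rep y \<longleftrightarrow> (\<exists>s\<in>S. \<exists>t\<in>S. \<exists>k::nat. s \<otimes> y = t \<otimes> p [^] k)" for y
  define B where "B = {y \<in> carrier R - {\<zero>}. \<not> rep y}"
  assume "\<not> locally_uniformizes p"
  then have "B \<noteq> {}" using pM unfolding locally_uniformizes_def B_def rep_def by blast
  have "\<exists>I\<in>sat ` B. \<forall>J\<in>sat ` B. I \<subseteq> J \<longrightarrow> J = I"
  proof (rule subset_Zorn_nonempty)
    show "sat ` B \<noteq> {}" using \<open>B \<noteq> {}\<close> by blast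
    fix C assume C: "C \<noteq> {}" "subset.chain (sat ` B) C"
    then have sub: "C \<subseteq> sat ` B" by (simp add: subset.chain_def)
    have "sat ` B \<subseteq> {I. ideal I R}" using sat_ideal unfolding B_def by blast
    then have "subset.chain {I. ideal I R} C"
      using C(2) order_trans[OF sub] by (simp add: subset.chain_def)
    \<comment> \<open>A nonempty chain of ideals in a Noetherian ring contains its union, which
      supplies the upper bound for Zorn's lemma.\<close>
    then have "\<Union>C \<in> C" by (rule noetherian_ring.ideal_chain_is_trivial[OF noeth C(1)])
    then show "\<Union>C \<in> sat ` B" using sub by (rule rev_subsetD)
  qed
  then obtain y where y: "y \<in> B" and max: "\<And>z. z \<in> B \<Longrightarrow> sat y \<subseteq> sat z \<Longrightarrow> sat z = sat y"
    by auto
  have yc: "y \<in> carrier R" "y \<noteq> \<zero>" "\<not> rep y" using y by (auto simp: B_def)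
  have "y \<in> M"
  proof (rule ccontr)
    assume "y \<notin> M"
    then have "y \<in> S" "\<one> \<otimes> y = y \<otimes> p [^] (0::nat)" using yc by auto
    then show False using yc(3) S_one unfolding rep_def by blast
  qed
  then obtain t b where t: "t \<in> S" "b \<in> carrier R" "t \<otimes> y = b \<otimes> p"
    using gen unfolding locally_generates_def by blast
  have b0: "b \<noteq> \<zero>"
  proof
    assume "b = \<zero>"
    then have "t \<otimes> y = \<zero>" using t(3) pM by simp
    then show False using t(1) yc S_nonzero by (auto simp: integral_iff)
  qed
  have "\<not> rep b"
  proof
    assume "rep b"
    then obtain s u k where s: "s \<in> S" "u \<in> S" "s \<otimes> b = u \<otimes> p [^] (k::nat)" unfolding rep_def by blast
    have "(s \<otimes> t) \<otimes> y = s \<otimes> (t \<otimes> y)" using s(1) t(1) yc by (simp add: m_assoc)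
    also have "\<dots> = (s \<otimes> b) \<otimes> p" unfolding t(3) using s(1) t(2) pM by (simp add: m_assoc)
    also have "\<dots> = u \<otimes> p [^] Suc k" unfolding s(3) using s(2) pM by (simp add: m_assoc)
    finally show False using yc(3) s(2) S_mult[OF s(1) t(1)] unfolding rep_def by blast
  qed
  then have "b \<in> B" using t(2) b0 by (simp add: B_def)
  moreover have "sat y \<subseteq> sat b"
  proof
    fix a assume "a \<in> sat y"
    then obtain s c where s: "a \<in> carrier R" "s \<in> S" "c \<in> carrier R" "s \<otimes> a = c \<otimes> y"
      unfolding sat_def by blast
    have "(t \<otimes> s) \<otimes> a = t \<otimes> (s \<otimes> a)" using t(1) s(1,2) by (simp add: m_assoc)
    also have "\<dots> = c \<otimes> (t \<otimes> y)" unfolding s(4) using t(1) s(3) yc by (simp add: m_ac)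
    also have "\<dots> = (c \<otimes> p) \<otimes> b" unfolding t(3) using t(2) s(3) pM by (simp add: m_ac)
    finally show "a \<in> sat b" using S_mult[OF t(1) s(2)] s(1,3) pM unfolding sat_def by blast
  qed
  ultimately have "b \<in> sat y" using max[of b] sat_self[OF t(2)] by blast
  \<comment> \<open>Locally \<open>b\<close> is a multiple of \<open>y\<close>, while
    \<open>y\<close> is \<open>p\<close> times \<open>b\<close>; substituting and cancelling
    \<open>y\<close> puts \<open>s \<otimes> t\<close> into \<open>M\<close>.\<close>
  then obtain s c where s: "s \<in> S" "c \<in> carrier R" "s \<otimes> b = c \<otimes> y" unfolding sat_def by blast
  have "(s \<otimes> t) \<otimes> y = s \<otimes> (t \<otimes> y)" using s(1) t(1) yc by (simp add: m_assoc)
  also have "\<dots> = (s \<otimes> b) \<otimes> p" unfolding t(3) using s(1) t(2) pM by (simp add: m_assoc)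
  also have "\<dots> = (c \<otimes> p) \<otimes> y" unfolding s(3) using s(2) pM yc by (simp add: m_ac)
  finally have "s \<otimes> t = c \<otimes> p"
    using m_rcancel[of y "s \<otimes> t" "c \<otimes> p"] yc s(1,2) t(1) pM by simp
  then have "s \<otimes> t \<in> M" using I_l_closed[OF pM(1) s(2)] by simp
  then show False using S_mult[OF s(1) t(1)] by blast
qed

end


section \<open>Krull dimension and integral closure\<close>

lemma krull_dim_ge_2:
  assumes "primeideal P R" "primeideal Q R" "primeideal M R" "P \<subset> Q" "Q \<subset> M"
  shows "2 \<le> krull_dim R"
proof -
  have "prime_chain R 2 (\<lambda>i. if i = 0 then P else if i = 1 then Q else M)"
    using assms by (auto simp: prime_chain_def less_2_cases_iff)
  then have "enat 2 \<le> krull_dim R" unfolding krull_dim_def by (intro SUP_upper) blast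
  then show ?thesis by (simp add: numeral_eq_enat)
qed

text \<open>An initial segment of a chain is a chain, so excluding length \<open>Suc n\<close>
  excludes all greater lengths.\<close>

lemma krull_dim_leI:
  assumes "\<And>P. \<not> prime_chain R (Suc n) P"
  shows "krull_dim R \<le> enat n"
  unfolding krull_dim_def
proof (rule SUP_least)
  fix k assume "k \<in> {k. \<exists>P. prime_chain R k P}"
  then obtain P where P: "prime_chain R k P" by blast
  have "k \<le> n"
  proof (rule ccontr)
    assume "\<not> k \<le> n"
    then have "prime_chain R (Suc n) P" using P by (auto simp: prime_chain_def)
    then show False using assms by blast
  qed
  then show "enat k \<le> enat n" by simp
qed

lemma krull_dim_le_1I:
  assumes "\<And>P Q M. \<lbrakk>primeideal P R; primeideal Q R; primeideal M R; P \<subset> Q; Q \<subset> M\<rbrakk> \<Longrightarrow> False"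
  shows "krull_dim R \<le> 1"
proof -
  have "\<not> prime_chain R (Suc 1) P" for P
  proof
    assume "prime_chain R (Suc 1) P"
    then have "primeideal (P 0) R" "primeideal (P 1) R" "primeideal (P 2) R" "P 0 \<subset> P 1" "P 1 \<subset> P 2"
      by (auto simp: prime_chain_def numeral_2_eq_2)
    then show False by (rule assms)
  qed
  from krull_dim_leI[OF this] show ?thesis by (simp add: one_enat_def)
qed

lemma (in field) krull_dim_field: "krull_dim R = 0"
proof -
  have zero: "P = {\<zero>}" if P: "primeideal P R" for P
  proof -
    interpret P: primeideal P R by (rule P)
    show ?thesis using all_ideals P.is_ideal P.I_notcarr by auto
  qed
  have "\<not> prime_chain R (Suc 0) P" for P
    using zero[of "P 0"] zero[of "P 1"] by (auto simp: prime_chain_def)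
  from krull_dim_leI[OF this] show ?thesis by (simp add: zero_enat_def[symmetric])
qed

text \<open>This is why valuation rings are integrally closed. If \<open>y\<close> is the inverse of
  \<open>x\<close> and the equation has degree \<open>n + 1\<close>, multiplication by
  \<open>y^n\<close> turns the leading term into \<open>x\<close> and each lower term
  \<open>c x^i\<close> into \<open>c y^(n - i)\<close>, which lies in \<open>B\<close>.\<close>

lemma (in cring) monic_root_mem_subring:
  assumes B: "subring B R" and x: "x \<in> carrier R" and y: "y \<in> B" and xy: "x \<otimes> y = \<one>"
    and p: "set p \<subseteq> B" "p \<noteq> []" "lead_coeff p = \<one>" "eval p x = \<zero>"
  shows "x \<in> B"
proof -
  note B_carr = subringE(1)[OF B, THEN subsetD]
  have yc: "y \<in> carrier R" using y B_carr by blast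
  have ypow: "y [^] (n::nat) \<in> B" for n
    using y subringE(3,6)[OF B] by (induction n) auto
  have xy_pow: "x [^] n \<otimes> y [^] m = y [^] (m - n)" if "n \<le> m" for n m :: nat
  proof -
    have "x [^] n \<otimes> y [^] m = (x [^] n \<otimes> y [^] n) \<otimes> y [^] (m - n)"
      using that x yc by (simp add: m_assoc nat_pow_mult)
    also have "x [^] n \<otimes> y [^] n = \<one>" using x yc xy nat_pow_distrib[of x y n] by simp
    finally show ?thesis using yc by simp
  qed
  \<comment> \<open>A coefficient list of length at most \<open>Suc m\<close> has degree at most
    \<open>m\<close>, so \<open>y [^] m\<close> clears every power of \<open>x\<close>.\<close>
  have mem: "eval q x \<otimes> y [^] m \<in> B" if "set q \<subseteq> B" "length q \<le> Suc m" for q m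
    using that
  proof (induction q)
    case Nil
    then show ?case using yc subringE(2)[OF B] by simp
  next
    case (Cons c q)
    have c: "c \<in> B" "c \<in> carrier R" "set q \<subseteq> carrier R" using Cons.prems(1) B_carr by auto
    have "eval (c # q) x \<otimes> y [^] m = c \<otimes> (x [^] length q \<otimes> y [^] m) \<oplus> eval q x \<otimes> y [^] m"
      using c x yc eval_in_carrier[of q x] by (simp add: l_distr m_assoc)
    also have "\<dots> = c \<otimes> y [^] (m - length q) \<oplus> eval q x \<otimes> y [^] m"
      using Cons.prems(2) xy_pow by simp
    also have "\<dots> \<in> B" using Cons c(1) ypow subringE(6,7)[OF B] by simp
    finally show ?case .
  qed
  obtain q where q: "p = \<one> # q" using p(2,3) by (cases p) auto
  have qB: "set q \<subseteq> B" "set q \<subseteq> carrier R" using p(1) q B_carr by auto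
  have e: "x [^] length q \<oplus> eval q x = \<zero>" using p(4) x by (simp add: q)
  show ?thesis
  proof (cases "length q")
    \<comment> \<open>Here \<open>p\<close> is the constant \<one>, and having a root makes the ring
      trivial, so \<open>x\<close> is zero.\<close>
    case 0
    then have "\<one> = \<zero>" using e by simp
    then have "x = \<zero>" using x one_zeroD by blast
    then show ?thesis using subringE(2)[OF B] by simp
  next
    case (Suc n)
    have ec: "eval q x \<in> carrier R" using qB(2) x by (rule eval_in_carrier)
    have "(x [^] Suc n \<oplus> eval q x) \<otimes> y [^] n = \<zero>" using e Suc yc by simp
    moreover have "x [^] Suc n \<otimes> y [^] n = x" using xy_pow[of n n] x yc
      by (simp add: m_ac)
    ultimately have "x \<oplus> eval q x \<otimes> y [^] n = \<zero>" using x yc ec by (simp add: l_distr)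
    then have "x = \<ominus> (eval q x \<otimes> y [^] n)" using x yc ec by (simp add: minus_equality)
    moreover have "\<ominus> (eval q x \<otimes> y [^] n) \<in> B"
      using mem[of q n] qB(1) Suc subringE(5)[OF B] by simp
    ultimately show ?thesis by (rule ssubst)
  qed
qed

section \<open>The localization as a valuation ring inside the fraction field\<close>

context domain_maximalideal
begin

text \<open>Since \<open>P\<close> avoids \<open>S\<close>, elements of \<open>S\<close> can be
  cancelled from products lying in \<open>P\<close>. A nonzero element of \<open>P\<close> thus
  yields a power of \<open>p\<close> in \<open>P\<close>, hence \<open>p\<close> itself, and
  \<open>p\<close> locally generates \<open>M\<close>.\<close>

lemma nonzero_prime_eq_M:
  assumes p: "locally_generates p" "locally_uniformizes p"
    and P: "primeideal P R" "P \<noteq> {\<zero>}" "P \<subseteq> M"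
  shows "P = M"
proof -
  interpret P: primeideal P R by (rule P)
  have pc: "p \<in> carrier R" using p(1) Icarr by (auto simp: locally_generates_def)
  have SP: "z \<in> P" if "t \<in> S" "z \<in> carrier R" "t \<otimes> z \<in> P" for t z
    using P.I_prime[of t z] that P(3) by auto
  obtain y where y: "y \<in> P" "y \<noteq> \<zero>" using P(2) P.zero_closed by blast
  then obtain s t k where s: "s \<in> S" "t \<in> S" "s \<otimes> y = t \<otimes> p [^] (k::nat)"
    using p(2) P.Icarr unfolding locally_uniformizes_def by blast
  have "t \<otimes> p [^] k \<in> P" using s(1) y(1) P.I_l_closed by (simp add: s(3)[symmetric])
  then have "p [^] k \<in> P" using SP[OF s(2)] pc by simp
  then have "p \<in> P"
  proof (induction k)
    case 0
    then show ?case using P(3) one_notin_M by auto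
  next
    case (Suc k)
    then show ?case using P.I_prime[of "p [^] k" p] pc by auto
  qed
  have "M \<subseteq> P"
  proof
    fix z assume z: "z \<in> M"
    then obtain t b where "t \<in> S" "b \<in> carrier R" "t \<otimes> z = b \<otimes> p"
      using p(1) unfolding locally_generates_def by blast
    then show "z \<in> P" using SP[of t z] Icarr[OF z] P.I_l_closed[OF \<open>p \<in> P\<close>] by simp
  qed
  then show ?thesis using P(3) by blast
qed

text \<open>The localization at \<open>M\<close>, realised inside the fraction field of \<open>R\<close>.\<close>

definition loc_subring :: "('a \<times> 'a) set set" where
  "loc_subring = {x \<in> carrier K. \<exists>t\<in>S. \<exists>r\<in>carrier R. \<iota> t \<otimes>\<^bsub>K\<^esub> x = \<iota> r}"

interpretation K: field K by (rule field_fraction_field)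

lemma frac_embed_mem_loc_subring:
  assumes "r \<in> carrier R"
  shows "\<iota> r \<in> loc_subring"
proof -
  have "\<iota> \<one> \<otimes>\<^bsub>K\<^esub> \<iota> r = \<iota> r" using assms by (simp add: frac_embed_mult[symmetric])
  then show ?thesis using assms S_one frac_embed_closed unfolding loc_subring_def by blast
qed

lemma loc_subringI:
  "\<lbrakk>x \<in> carrier K; t \<in> S; r \<in> carrier R; \<iota> t \<otimes>\<^bsub>K\<^esub> x = \<iota> r\<rbrakk> \<Longrightarrow> x \<in> loc_subring"
  unfolding loc_subring_def by blast

lemma loc_subringE:
  assumes "x \<in> loc_subring"
  obtains t r where "x \<in> carrier K" "t \<in> S" "r \<in> carrier R" "\<iota> t \<otimes>\<^bsub>K\<^esub> x = \<iota> r"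
  using assms unfolding loc_subring_def by blast

lemma subring_loc_subring: "subring loc_subring K"
proof (rule K.subringI)
  show "loc_subring \<subseteq> carrier K" by (auto simp: loc_subring_def)
  show "\<one>\<^bsub>K\<^esub> \<in> loc_subring"
    using frac_embed_mem_loc_subring[OF one_closed] by (simp add: frac_embed_one)
next
  fix x y assume "x \<in> loc_subring" "y \<in> loc_subring"
  then obtain s a t b where x: "x \<in> carrier K" "s \<in> S" "a \<in> carrier R" "\<iota> s \<otimes>\<^bsub>K\<^esub> x = \<iota> a"
    and y: "y \<in> carrier K" "t \<in> S" "b \<in> carrier R" "\<iota> t \<otimes>\<^bsub>K\<^esub> y = \<iota> b"
    by (elim loc_subringE)
  have st: "s \<in> carrier R" "t \<in> carrier R" using x y by auto
  note [simp] = frac_embed_closed frac_embed_mult frac_embed_add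
  have "\<iota> (s \<otimes> t) \<otimes>\<^bsub>K\<^esub> (x \<otimes>\<^bsub>K\<^esub> y) = (\<iota> s \<otimes>\<^bsub>K\<^esub> x) \<otimes>\<^bsub>K\<^esub> (\<iota> t \<otimes>\<^bsub>K\<^esub> y)"
    using st x(1) y(1) by (simp add: K.m_ac)
  also have "\<dots> = \<iota> (a \<otimes> b)" using x(3) y(3) by (simp add: x(4) y(4))
  finally show "x \<otimes>\<^bsub>K\<^esub> y \<in> loc_subring"
    using x y S_mult by (intro loc_subringI[of _ "s \<otimes> t" "a \<otimes> b"]) auto
  have "\<iota> (s \<otimes> t) \<otimes>\<^bsub>K\<^esub> (x \<oplus>\<^bsub>K\<^esub> y) =
      \<iota> t \<otimes>\<^bsub>K\<^esub> (\<iota> s \<otimes>\<^bsub>K\<^esub> x) \<oplus>\<^bsub>K\<^esub> \<iota> s \<otimes>\<^bsub>K\<^esub> (\<iota> t \<otimes>\<^bsub>K\<^esub> y)"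
    using st x(1) y(1) by (simp add: K.m_ac K.r_distr)
  also have "\<dots> = \<iota> (t \<otimes> a \<oplus> s \<otimes> b)" using st x(3) y(3) by (simp add: x(4) y(4))
  finally show "x \<oplus>\<^bsub>K\<^esub> y \<in> loc_subring"
    using x y st S_mult by (intro loc_subringI[of _ "s \<otimes> t" "t \<otimes> a \<oplus> s \<otimes> b"]) auto
next
  fix x assume "x \<in> loc_subring"
  then obtain s a where x: "x \<in> carrier K" "s \<in> S" "a \<in> carrier R" "\<iota> s \<otimes>\<^bsub>K\<^esub> x = \<iota> a"
    by (elim loc_subringE)
  have m1: "\<iota> (\<ominus> \<one>) \<otimes>\<^bsub>K\<^esub> x = \<ominus>\<^bsub>K\<^esub> x"
  proof -
    have "\<iota> (\<ominus> \<one>) \<oplus>\<^bsub>K\<^esub> \<iota> \<one> = \<zero>\<^bsub>K\<^esub>"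
      by (simp add: frac_embed_add[symmetric] l_neg frac_embed_zero)
    then have "\<iota> (\<ominus> \<one>) = \<ominus>\<^bsub>K\<^esub> \<one>\<^bsub>K\<^esub>"
      using K.minus_equality[of "\<iota> (\<ominus> \<one>)" "\<iota> \<one>"] by (simp add: frac_embed_closed frac_embed_one)
    then show ?thesis using x(1) by (simp add: K.l_minus)
  qed
  have "\<iota> s \<otimes>\<^bsub>K\<^esub> (\<iota> (\<ominus> \<one>) \<otimes>\<^bsub>K\<^esub> x) = \<iota> (\<ominus> \<one>) \<otimes>\<^bsub>K\<^esub> (\<iota> s \<otimes>\<^bsub>K\<^esub> x)"
    using x(1-3) by (simp add: K.m_ac frac_embed_closed)
  also have "\<dots> = \<iota> (\<ominus> \<one> \<otimes> a)" using x(3) by (simp add: x(4) frac_embed_mult)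
  finally show "\<ominus>\<^bsub>K\<^esub> x \<in> loc_subring"
    unfolding m1 using x by (intro loc_subringI[of _ s "\<ominus> \<one> \<otimes> a"]) auto
qed

text \<open>Up to a unit of \<open>R\<^sub>M\<close>, \<open>x = a / s\<close> is \<open>p\<close>
  to the power \<open>j - i\<close>. The computation is done after multiplication by
  \<open>p^i\<close>, which is cancelled at the end.\<close>

lemma mem_loc_subring_if_le:
  assumes p: "p \<in> carrier R" "p \<noteq> \<zero>" and x: "x \<in> carrier K" "\<iota> s \<otimes>\<^bsub>K\<^esub> x = \<iota> a"
    and "s \<in> carrier R" "a \<in> carrier R"
    and u: "u \<in> S" "t \<in> S" "u \<otimes> s = t \<otimes> p [^] i"
    and v: "v \<in> S" "w \<in> S" "v \<otimes> a = w \<otimes> p [^] j" and le: "i \<le> (j::nat)"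
  shows "x \<in> loc_subring"
proof -
  note [simp] = frac_embed_closed
  obtain d where j: "j = i + d" using le le_Suc_ex by blast
  have c: "u \<in> carrier R" "t \<in> carrier R" "v \<in> carrier R" "w \<in> carrier R" using u v by auto
  have pi0: "p [^] i \<noteq> \<zero>" using p by (induction i) (auto simp: integral_iff)
  have "\<iota> (p [^] i) \<otimes>\<^bsub>K\<^esub> (\<iota> (v \<otimes> t) \<otimes>\<^bsub>K\<^esub> x) = \<iota> (v \<otimes> (t \<otimes> p [^] i)) \<otimes>\<^bsub>K\<^esub> x"
    using c p x(1) by (simp add: frac_embed_mult K.m_ac)
  also have "\<dots> = \<iota> (u \<otimes> v) \<otimes>\<^bsub>K\<^esub> (\<iota> s \<otimes>\<^bsub>K\<^esub> x)"
    unfolding u(3)[symmetric] using c assms(5) x(1) by (simp add: frac_embed_mult K.m_ac)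
  also have "\<dots> = \<iota> (u \<otimes> (v \<otimes> a))"
    unfolding x(2) using c assms(6) by (simp add: frac_embed_mult[symmetric] m_ac)
  also have "\<dots> = \<iota> (p [^] i) \<otimes>\<^bsub>K\<^esub> \<iota> (u \<otimes> w \<otimes> p [^] d)"
    unfolding v(3) j using c p(1) by (simp add: frac_embed_mult[symmetric] nat_pow_mult[symmetric] m_ac)
  finally have "\<iota> (v \<otimes> t) \<otimes>\<^bsub>K\<^esub> x = \<iota> (u \<otimes> w \<otimes> p [^] d)"
    using K.m_lcancel[of "\<iota> (p [^] i)" "\<iota> (v \<otimes> t) \<otimes>\<^bsub>K\<^esub> x" "\<iota> (u \<otimes> w \<otimes> p [^] d)"] c p x(1) pi0
    by (simp add: frac_embed_eq_zero)
  then show ?thesis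
    using x(1) c p(1) S_mult[OF v(1) u(2)] by (intro loc_subringI[of _ "v \<otimes> t" "u \<otimes> w \<otimes> p [^] d"]) auto
qed

text \<open>The exponents of numerator and denominator of \<open>x\<close> are compared: if that of
  the numerator is smaller, the roles are exchanged and the inverse of \<open>x\<close> lies in the
  localization.\<close>

lemma loc_subring_valuation:
  assumes p: "locally_uniformizes p" "p \<noteq> \<zero>" and x: "x \<in> carrier K"
  shows "x \<in> loc_subring \<or> (\<exists>y\<in>loc_subring. x \<otimes>\<^bsub>K\<^esub> y = \<one>\<^bsub>K\<^esub>)"
proof (cases "x = \<zero>\<^bsub>K\<^esub>")
  case True
  then show ?thesis using frac_embed_mem_loc_subring[of \<zero>] by (simp add: frac_embed_zero)
next
  case False
  then have "x \<in> Units K" using x by (simp add: K.field_Units)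
  then obtain y where y: "y \<in> carrier K" "x \<otimes>\<^bsub>K\<^esub> y = \<one>\<^bsub>K\<^esub>"
    using K.Units_inv_closed K.Units_r_inv by blast
  obtain a s where as: "a \<in> carrier R" "s \<in> carrier R" "s \<noteq> \<zero>" "\<iota> s \<otimes>\<^bsub>K\<^esub> x = \<iota> a"
    using fraction_field_cases[OF x] .
  have ya: "\<iota> a \<otimes>\<^bsub>K\<^esub> y = \<iota> s"
    using as(2) x y by (simp add: as(4)[symmetric] K.m_assoc frac_embed_closed)
  have a0: "a \<noteq> \<zero>"
  proof
    assume "a = \<zero>"
    then have "\<iota> s = \<zero>\<^bsub>K\<^esub>" using ya y(1) by (simp add: frac_embed_zero)
    then show False using as(2,3) by (simp add: frac_embed_eq_zero)
  qed
  have pc: "p \<in> carrier R" using p(1) Icarr by (auto simp: locally_uniformizes_def)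
  obtain u t i where u: "u \<in> S" "t \<in> S" "u \<otimes> s = t \<otimes> p [^] (i::nat)"
    using p(1) as(2,3) unfolding locally_uniformizes_def by blast
  obtain v w j where v: "v \<in> S" "w \<in> S" "v \<otimes> a = w \<otimes> p [^] (j::nat)"
    using p(1) as(1) a0 unfolding locally_uniformizes_def by blast
  show ?thesis
  proof (cases "i \<le> j")
    case True
    then show ?thesis using mem_loc_subring_if_le[OF pc p(2) x as(4,2,1) u v] by blast
  next
    case False
    then have "y \<in> loc_subring" using mem_loc_subring_if_le[OF pc p(2) y(1) ya as(1,2) v u] by simp
    then show ?thesis using y(2) by blast
  qed
qed

end

section \<open>Integral closedness from the localizations\<close>

context domain
begin

interpretation K: field K by (rule field_fraction_field)

text \<open>For \<open>x\<close> integral over \<open>R\<close>, let \<open>D\<close> be the ideal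
  of its denominators. If \<open>D\<close> lay in a maximal ideal \<open>M\<close>, integral
  closedness of the valuation ring \<open>R\<^sub>M\<close> would put \<open>x\<close> into
  \<open>R\<^sub>M\<close> and give a denominator outside \<open>M\<close>. Hence \<one> is a
  denominator.\<close>

lemma integrally_closed_if_locally_uniformizes:
  assumes loc: "\<And>M. \<lbrakk>maximalideal M R; M \<noteq> {\<zero>}\<rbrakk> \<Longrightarrow>
    \<exists>p. p \<noteq> \<zero> \<and> domain_maximalideal.locally_uniformizes M R p"
  shows "integrally_closed R"
  unfolding integrally_closed_def
proof (intro ballI impI, elim exE conjE)
  fix x p assume x: "x \<in> carrier K" and p: "polynomial\<^bsub>K\<^esub> (\<iota> ` carrier R) p" "p \<noteq> []"
    "lead_coeff p = \<one>\<^bsub>K\<^esub>" "K.eval p x = \<zero>\<^bsub>K\<^esub>"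
  define D where "D = {d \<in> carrier R. \<iota> d \<otimes>\<^bsub>K\<^esub> x \<in> \<iota> ` carrier R}"
  have D: "ideal D R"
  proof (rule idealI')
    show "D \<subseteq> carrier R" by (auto simp: D_def)
    have "\<iota> \<zero> \<otimes>\<^bsub>K\<^esub> x = \<iota> \<zero>" using x by (simp add: frac_embed_zero)
    then show "\<zero> \<in> D" by (simp add: D_def)
  next
    fix a b assume "a \<in> D" "b \<in> D"
    then obtain r q where *: "a \<in> carrier R" "b \<in> carrier R" "r \<in> carrier R" "q \<in> carrier R"
      "\<iota> a \<otimes>\<^bsub>K\<^esub> x = \<iota> r" "\<iota> b \<otimes>\<^bsub>K\<^esub> x = \<iota> q" by (auto simp: D_def)
    have "\<iota> (a \<oplus> b) \<otimes>\<^bsub>K\<^esub> x = \<iota> (r \<oplus> q)"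
      using * x by (simp add: frac_embed_add frac_embed_closed K.l_distr)
    then show "a \<oplus> b \<in> D" using * by (simp add: D_def)
  next
    fix r a assume r: "r \<in> carrier R" and "a \<in> D"
    then obtain q where *: "a \<in> carrier R" "q \<in> carrier R" "\<iota> a \<otimes>\<^bsub>K\<^esub> x = \<iota> q" by (auto simp: D_def)
    have "\<iota> (r \<otimes> a) \<otimes>\<^bsub>K\<^esub> x = \<iota> (r \<otimes> q)"
      using * r x by (simp add: frac_embed_mult frac_embed_closed K.m_assoc)
    then show "r \<otimes> a \<in> D" using * r by (simp add: D_def)
  qed
  have "D = carrier R"
  proof (rule ccontr)
    assume "D \<noteq> carrier R"
    then obtain M where M: "maximalideal M R" "D \<subseteq> M"
      using exists_maximalideal_superset[OF D] by blast
    interpret domain_maximalideal M R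
      using M(1) domain_axioms by (simp add: domain_maximalideal_def)
    obtain a s where "a \<in> carrier R" "s \<in> carrier R" "s \<noteq> \<zero>" "\<iota> s \<otimes>\<^bsub>K\<^esub> x = \<iota> a"
      using fraction_field_cases[OF x] .
    \<comment> \<open>A nonzero denominator of \<open>x\<close> shows that \<open>M\<close> is
      nonzero, as \<open>loc\<close> requires.\<close>
    then have "s \<in> M" "s \<noteq> \<zero>" using M(2) by (auto simp: D_def)
    then obtain q where q: "q \<noteq> \<zero>" "locally_uniformizes q" using loc[OF M(1)] by blast
    have "x \<in> loc_subring"
    proof (rule ccontr)
      assume no: "x \<notin> loc_subring"
      then obtain y where y: "y \<in> loc_subring" "x \<otimes>\<^bsub>K\<^esub> y = \<one>\<^bsub>K\<^esub>"
        using loc_subring_valuation[OF q(2,1) x] by blast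
      have "set p \<subseteq> loc_subring"
        using p(1,2) frac_embed_mem_loc_subring by (auto simp: polynomial_def)
      then show False
        using no K.monic_root_mem_subring[OF subring_loc_subring x y _ p(2,3,4)] by blast
    qed
    then obtain t r where t: "t \<in> S" "r \<in> carrier R" "\<iota> t \<otimes>\<^bsub>K\<^esub> x = \<iota> r" by (elim loc_subringE)
    then have "t \<in> D" by (simp add: D_def)
    then show False using M(2) t(1) by blast
  qed
  then have "\<one> \<in> D" by simp
  then show "x \<in> \<iota> ` carrier R" using x by (simp add: D_def frac_embed_one)
qed

end

section \<open>From the local statements to almost Dedekind and Dedekind domains\<close>

theorem corollary4:
  fixes R :: "('a, 'b) ring_scheme"
  assumes "ISP_domain R"
  shows "(krull_dim R = 1 \<longrightarrow> almost_Dedekind R) \<and> (noetherian_ring R \<longrightarrow> Dedekind_domain R)"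
proof (intro conjI impI)
  interpret domain R using assms by (simp add: ISP_domain_def)
  have max: "domain_maximalideal M R" if "maximalideal M R" for M
    using that domain_axioms by (simp add: domain_maximalideal_def)
  {
    assume dim: "krull_dim R = 1"
    have "DVR (localization_at R M)" if M: "maximalideal M R" for M
    proof -
      interpret domain_maximalideal M R using M by (rule max)
      \<comment> \<open>A zero maximal ideal would make \<open>R\<close> a field, of dimension
        zero.\<close>
      have M0: "M \<noteq> {\<zero>\<^bsub>R\<^esub>}"
      proof
        assume "M = {\<zero>\<^bsub>R\<^esub>}"
        then have "field R" using zeromaximalideal_fieldI M by blast
        then show False using field.krull_dim_field dim by fastforce
      qed
      have "P = M" if P: "primeideal P R" "P \<noteq> {\<zero>\<^bsub>R\<^esub>}" "P \<subseteq> M" for P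
      proof (rule ccontr)
        assume "P \<noteq> M"
        interpret P: primeideal P R by (rule P)
        \<comment> \<open>The chain is the zero ideal, \<open>P\<close>, \<open>M\<close>.\<close>
        have "2 \<le> krull_dim R"
          using P \<open>P \<noteq> M\<close> P.zero_closed
          by (intro krull_dim_ge_2[OF zeroprimeideal P(1) maximalideal_prime[OF M]]) auto
        then show False by (simp add: dim one_enat_def numeral_eq_enat)
      qed
      then show ?thesis using DVR_localization_if_one_dim[OF assms M0] by blast
    qed
    then show "almost_Dedekind R" using domain_axioms by (simp add: almost_Dedekind_def)
  }
  assume noeth: "noetherian_ring R"
  have loc: "\<exists>p. p \<noteq> \<zero>\<^bsub>R\<^esub> \<and> domain_maximalideal.locally_generates M R p \<and>
      domain_maximalideal.locally_uniformizes M R p"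
    if M: "maximalideal M R" "M \<noteq> {\<zero>\<^bsub>R\<^esub>}" for M
  proof -
    interpret domain_maximalideal M R using M(1) by (rule max)
    obtain p where p: "locally_generates p"
      using locally_generates_if_noetherian[OF assms noeth M(2)] .
    then show ?thesis
      using locally_generates_nonzero[OF p M(2)] locally_uniformizes_if_noetherian[OF noeth p] by blast
  qed
  have "krull_dim R \<le> 1"
  proof (rule krull_dim_le_1I)
    fix P Q N assume *: "primeideal P R" "primeideal Q R" "primeideal N R" "P \<subset> Q" "Q \<subset> N"
    interpret P: primeideal P R by (rule *)
    interpret N: primeideal N R by (rule *)
    \<comment> \<open>Passing to a maximal ideal above \<open>N\<close> makes the local results
      available: the nonzero prime \<open>Q\<close> must equal \<open>M\<close>, yet it is strictly
      inside \<open>N\<close>.\<close>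
    obtain M where M: "maximalideal M R" "N \<subseteq> M"
      using exists_maximalideal_superset[OF N.is_ideal] N.I_notcarr by metis
    interpret domain_maximalideal M R using M(1) by (rule max)
    have Q0: "Q \<noteq> {\<zero>\<^bsub>R\<^esub>}" using *(4) P.zero_closed by blast
    moreover have "M \<noteq> {\<zero>\<^bsub>R\<^esub>}" using *(4,5) M(2) P.zero_closed by blast
    ultimately obtain p where "locally_generates p" "locally_uniformizes p" using loc[OF M(1)] by blast
    then have "Q = M" using *(2,5) Q0 M(2) by (intro nonzero_prime_eq_M) auto
    then show False using *(5) M(2) by blast
  qed
  moreover have "integrally_closed R"
    using loc by (intro integrally_closed_if_locally_uniformizes) blast
  ultimately show "Dedekind_domain R"
    using noeth domain_axioms by (simp add: Dedekind_domain_def noetherian_domain_def)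
qed

end
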